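(* Let $G$ be a finite group, $X$ a $G$-homogeneous space, and $Q_1,\dots,Q_m$ probability distributions on $G$. For a word $w=w_1\cdots w_N$ with $w_i\in\{1,\dots,m\}$ let $Q^{(w)}:=Q_{w_1}\ast\cdots\ast Q_{w_N}$ and $q^{(w)}:=\sum_{g\in G}Q^{(w)}(g)e_g\in\mathbb{C}G$. Then \[\lim_{N\rightarrow \infty} \left(\max_{x_0\in X,\ w:|w|=N}\|q^{(w)}\cdot e_{x_0} -\overline{u}\|_{\rm TV}\right)^{\frac{1}{N}}=\overline{\omega}_X\left(Q_1,\dots, Q_m\right),\] where the maximum is over all words $w$ of length $N$ and all $x_0\in X$. Furthermore, $\{Q_1,\dots,Q_m\}$ has the adversarial mixing property on $X$ if and only if $\overline{\omega}_X(Q_1,\dots,Q_m)<1$.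
   Context: Convolution: $(P\ast R)(h)=\sum_{g}P(hg^{-1})R(g)$. A $G$-homogeneous space is a finite set $X$ with transitive $G$-action; $\mathbb{C}X$ has basis $\{e_x\}$ and is a $\mathbb{C}G$-module via $e_g\cdot e_x:=e_{g(x)}$. $\|h\|_{\rm TV}:=\frac12\sum_x|h(x)|$; $\overline{u}:=\frac1{|X|}\sum_x e_x$. Let $(V_j,\rho_j)$ be the irreducible complex representations of $G$, each with a fixed orthonormal basis $B_j$ for a $G$-invariant inner product, and $\hat{Q}(\rho_j):=\sum_gQ(g)[\rho_j(g)]_{B_j}$. The joint spectral radius of complex square matrices $A_1,\dots,A_m$ is ${\rm jsr}(A_1,\dots,A_m):=\lim_{N\to\infty}\max_{|w|=N}\|A_{w_1}\cdots A_{w_N}\|^{1/N}$ (independent of the matrix norm). The Fourier joint spectral radius relative to $X$ is $\overline{\omega}_X(Q_1,\dots,Q_m):=\max\{{\rm jsr}(\widehat{Q_1}(\rho_j),\dots,\widehat{Q_m}(\rho_j))\}$, the maximum over nontrivial irreducible $\rho_j$ appearing with nonzero multiplicity in $\mathbb{C}X$. The set $\{Q_1,\dots,Q_m\}$ has the adversarial mixing property on $X$ if $\lim_{N\to\infty}\max_{x_0\in X,|w|=N}\|q^{(w)}\cdot e_{x_0}-\overline{u}\|_{\rm TV}=0$. *)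

theory Defs
  imports "HOL-Algebra.Group_Action" "Jordan_Normal_Form.Matrix"
begin

definition prob_dist :: "('g, 'b) monoid_scheme \<Rightarrow> ('g \<Rightarrow> real) \<Rightarrow> bool" where
  "prob_dist G P \<longleftrightarrow> (\<forall>g\<in>carrier G. P g \<ge> 0) \<and> (\<Sum>g\<in>carrier G. P g) = 1"

definition conv :: "('g, 'b) monoid_scheme \<Rightarrow> ('g \<Rightarrow> real) \<Rightarrow> ('g \<Rightarrow> real) \<Rightarrow> 'g \<Rightarrow> real" where
  "conv G P R h = (\<Sum>g\<in>carrier G. P (h \<otimes>\<^bsub>G\<^esub> inv\<^bsub>G\<^esub> g) * R g)"

fun conv_word :: "('g, 'b) monoid_scheme \<Rightarrow> (nat \<Rightarrow> 'g \<Rightarrow> real) \<Rightarrow> nat list \<Rightarrow> 'g \<Rightarrow> real" where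
  "conv_word G Q [] = (\<lambda>g. if g = \<one>\<^bsub>G\<^esub> then 1 else 0)"
| "conv_word G Q (a # w) = conv G (Q a) (conv_word G Q w)"

definition words :: "nat \<Rightarrow> nat \<Rightarrow> nat list set" where
  "words m N = {w. length w = N \<and> set w \<subseteq> {1..m}}"

text \<open>The coefficient of e_x in q \<cdot> e_{x0} = sum_g q(g) e_{g(x0)}.\<close>
definition act_point :: "('g, 'b) monoid_scheme \<Rightarrow> ('g \<Rightarrow> 'x \<Rightarrow> 'x) \<Rightarrow> ('g \<Rightarrow> real) \<Rightarrow> 'x \<Rightarrow> 'x \<Rightarrow> real" where
  "act_point G \<phi> P x0 x = (\<Sum>g\<in>{g\<in>carrier G. \<phi> g x0 = x}. P g)"

definition tv_to_uniform :: "('g, 'b) monoid_scheme \<Rightarrow> 'x set \<Rightarrow> ('g \<Rightarrow> 'x \<Rightarrow> 'x) \<Rightarrow> ('g \<Rightarrow> real) \<Rightarrow> 'x \<Rightarrow> real" where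
  "tv_to_uniform G X \<phi> P x0 = (1/2) * (\<Sum>x\<in>X. \<bar>act_point G \<phi> P x0 x - 1 / real (card X)\<bar>)"

definition max_dist :: "('g, 'b) monoid_scheme \<Rightarrow> 'x set \<Rightarrow> ('g \<Rightarrow> 'x \<Rightarrow> 'x) \<Rightarrow> nat \<Rightarrow> (nat \<Rightarrow> 'g \<Rightarrow> real) \<Rightarrow> nat \<Rightarrow> real" where
  "max_dist G X \<phi> m Q N = Max {tv_to_uniform G X \<phi> (conv_word G Q w) x0 | x0 w. x0 \<in> X \<and> w \<in> words m N}"

definition adversarial_mixing :: "('g, 'b) monoid_scheme \<Rightarrow> 'x set \<Rightarrow> ('g \<Rightarrow> 'x \<Rightarrow> 'x) \<Rightarrow> nat \<Rightarrow> (nat \<Rightarrow> 'g \<Rightarrow> real) \<Rightarrow> bool" where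
  "adversarial_mixing G X \<phi> m Q \<longleftrightarrow> (max_dist G X \<phi> m Q \<longlonglongrightarrow> 0)"

text \<open>Frobenius norm (jsr is independent of the chosen matrix norm).\<close>
definition mat_norm :: "complex mat \<Rightarrow> real" where
  "mat_norm A = sqrt (\<Sum>i<dim_row A. \<Sum>j<dim_col A. (cmod (A $$ (i, j)))\<^sup>2)"

definition word_prod :: "nat \<Rightarrow> (nat \<Rightarrow> complex mat) \<Rightarrow> nat list \<Rightarrow> complex mat" where
  "word_prod n A w = foldr (\<lambda>a M. A a * M) w (1\<^sub>m n)"

definition jsr :: "nat \<Rightarrow> nat \<Rightarrow> (nat \<Rightarrow> complex mat) \<Rightarrow> real" where
  "jsr n m A = lim (\<lambda>N. (Max {mat_norm (word_prod n A w) | w. w \<in> words m N}) powr (1 / real N))"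

definition subspace_vec :: "nat \<Rightarrow> complex vec set \<Rightarrow> bool" where
  "subspace_vec n W \<longleftrightarrow> W \<subseteq> carrier_vec n \<and> 0\<^sub>v n \<in> W \<and>
     (\<forall>v\<in>W. \<forall>u\<in>W. v + u \<in> W) \<and> (\<forall>c. \<forall>v\<in>W. c \<cdot>\<^sub>v v \<in> W)"

text \<open>A unitary matrix representation of G of degree n (matrices w.r.t. an orthonormal basis
  of a G-invariant inner product).\<close>
definition unitary_rep :: "('g, 'b) monoid_scheme \<Rightarrow> nat \<Rightarrow> ('g \<Rightarrow> complex mat) \<Rightarrow> bool" where
  "unitary_rep G n \<rho> \<longleftrightarrow>
     (\<forall>g\<in>carrier G. \<rho> g \<in> carrier_mat n n \<and> \<rho> g * mat n n (\<lambda>(i, j). cnj (\<rho> g $$ (j, i))) = 1\<^sub>m n) \<and>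
     \<rho> \<one>\<^bsub>G\<^esub> = 1\<^sub>m n \<and>
     (\<forall>g\<in>carrier G. \<forall>h\<in>carrier G. \<rho> (g \<otimes>\<^bsub>G\<^esub> h) = \<rho> g * \<rho> h)"

definition irreducible_rep :: "('g, 'b) monoid_scheme \<Rightarrow> nat \<Rightarrow> ('g \<Rightarrow> complex mat) \<Rightarrow> bool" where
  "irreducible_rep G n \<rho> \<longleftrightarrow> n > 0 \<and>
     (\<forall>W. subspace_vec n W \<and> (\<forall>g\<in>carrier G. \<forall>v\<in>W. \<rho> g *\<^sub>v v \<in> W)
          \<longrightarrow> W = {0\<^sub>v n} \<or> W = carrier_vec n)"

definition trivial_rep :: "('g, 'b) monoid_scheme \<Rightarrow> nat \<Rightarrow> ('g \<Rightarrow> complex mat) \<Rightarrow> bool" where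
  "trivial_rep G n \<rho> \<longleftrightarrow> n = 1 \<and> (\<forall>g\<in>carrier G. \<rho> g = 1\<^sub>m 1)"

text \<open>rho appears with nonzero multiplicity in CX: there is an injective G-equivariant linear map
  T : C^n \<rightarrow> CX, T(v) = sum_i v_i f_i, where g acts on CX by (g.F)(x) = F(g^-1 x)
  (i.e. e_g . e_x = e_{g x}).\<close>
definition appears_in :: "('g, 'b) monoid_scheme \<Rightarrow> 'x set \<Rightarrow> ('g \<Rightarrow> 'x \<Rightarrow> 'x) \<Rightarrow> nat \<Rightarrow> ('g \<Rightarrow> complex mat) \<Rightarrow> bool" where
  "appears_in G X \<phi> n \<rho> \<longleftrightarrow> (\<exists>f :: nat \<Rightarrow> 'x \<Rightarrow> complex.
     (\<forall>v\<in>carrier_vec n. (\<forall>x\<in>X. (\<Sum>i<n. v $ i * f i x) = 0) \<longrightarrow> v = 0\<^sub>v n) \<and>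
     (\<forall>g\<in>carrier G. \<forall>v\<in>carrier_vec n. \<forall>x\<in>X.
        (\<Sum>i<n. (\<rho> g *\<^sub>v v) $ i * f i x) = (\<Sum>i<n. v $ i * f i (\<phi> (inv\<^bsub>G\<^esub> g) x))))"

definition fourier :: "('g, 'b) monoid_scheme \<Rightarrow> nat \<Rightarrow> ('g \<Rightarrow> complex mat) \<Rightarrow> ('g \<Rightarrow> real) \<Rightarrow> complex mat" where
  "fourier G n \<rho> P = mat n n (\<lambda>(i, j). \<Sum>g\<in>carrier G. complex_of_real (P g) * \<rho> g $$ (i, j))"

text \<open>Fourier joint spectral radius relative to X (0 if no nontrivial irreducible appears).\<close>
definition fourier_jsr :: "('g, 'b) monoid_scheme \<Rightarrow> 'x set \<Rightarrow> ('g \<Rightarrow> 'x \<Rightarrow> 'x) \<Rightarrow> nat \<Rightarrow> (nat \<Rightarrow> 'g \<Rightarrow> real) \<Rightarrow> real" where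
  "fourier_jsr G X \<phi> m Q = Sup (insert 0
     {jsr n m (\<lambda>i. fourier G n \<rho> (Q i)) | n \<rho>.
        unitary_rep G n \<rho> \<and> irreducible_rep G n \<rho> \<and> \<not> trivial_rep G n \<rho> \<and> appears_in G X \<phi> n \<rho>})"

end

theory Submission
  imports Defs "HOL-Analysis.L2_Norm" "Jordan_Normal_Form.Determinant"
begin

text \<open>Let \<open>D N\<close> be the maximal total variation distance. On functions of sum zero the transition
  kernel of a word may be replaced by its deviation from the uniform kernel, so \<open>2 D\<close> is
  submultiplicative and, by Fekete's lemma, its roots converge to a limit \<open>L\<close> bounded by each of
  them; in particular \<open>L < 1\<close> as soon as \<open>D\<close> tends to \<open>0\<close>.

  A nontrivial irreducible \<open>\<rho>\<close> embedded in \<open>\<complex>X\<close> lands in the functions of sum zero, and a linear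
  left inverse of the embedding bounds the Fourier matrix of a word of length \<open>N\<close> by a constant
  times \<open>D N\<close>; hence every joint spectral radius involved is at most \<open>L\<close>. Conversely, if \<open>r\<close>
  exceeds all of them, splitting off orthogonal complements of invariant subspaces shows that every
  function of sum zero decays like \<open>r ^ N\<close> under words of length \<open>N\<close>. Applied to the finitely many
  centered point masses this gives \<open>L \<le> r\<close>.\<close>

section \<open>Growth rates and the joint spectral radius\<close>

lemma le_power_if_powr_inverse_le:
  fixes x y :: real
  assumes "0 \<le> x" "x powr (1 / real n) \<le> y" "0 < n"
  shows "x \<le> y ^ n"
proof -
  have "x = (x powr (1 / real n)) ^ n"
    using assms by (cases "x = 0") (auto simp: powr_powr zero_power simp flip: powr_realpow)
  also have "\<dots> \<le> y ^ n"
    using assms by (intro power_mono) auto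
  finally show ?thesis .
qed

lemma const_powr_inverse_LIMSEQ:
  assumes "(0::real) < C"
  shows "(\<lambda>n. C powr (1 / real n)) \<longlonglongrightarrow> 1"
proof -
  have "(\<lambda>n. C powr (1 / real n)) \<longlonglongrightarrow> C powr 0"
    using assms by (intro tendsto_intros lim_1_over_n) auto
  then show ?thesis using assms by simp
qed

text \<open>Multiplicative constants are invisible to growth rates, because the n-th roots of
  \<open>C\<close> tend to 1.\<close>

lemma limit_le_if_le_geometric:
  fixes a :: "nat \<Rightarrow> real"
  assumes "\<And>n. 0 \<le> a n" "0 < C" "0 < r" "\<And>n. a n \<le> C * r ^ n"
    and lim: "(\<lambda>n. a n powr (1 / real n)) \<longlonglongrightarrow> L"
  shows "L \<le> r"
proof -
  have "(\<lambda>n. C powr (1 / real n) * r) \<longlonglongrightarrow> 1 * r"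
    by (intro tendsto_mult const_powr_inverse_LIMSEQ tendsto_const assms)
  moreover have "a n powr (1 / real n) \<le> C powr (1 / real n) * r" if "n \<ge> 1" for n
  proof -
    have "a n powr (1 / real n) \<le> (C * r ^ n) powr (1 / real n)"
      using assms by (intro powr_mono2) auto
    also have "\<dots> = C powr (1 / real n) * r"
      using assms that by (simp add: powr_mult powr_powr flip: powr_realpow)
    finally show ?thesis .
  qed
  ultimately show ?thesis using lim by (intro LIMSEQ_le[OF lim]) auto
qed

text \<open>Converse direction: the bound by \<open>r ^ n\<close> holds from some index on, and a
  constant absorbs the finitely many earlier terms, so that it holds for all
  \<open>n\<close>.\<close>

lemma le_geometric_if_limit_less:
  fixes a :: "nat \<Rightarrow> real"
  assumes nonneg: "\<And>n. 0 \<le> a n"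
    and lim: "(\<lambda>n. a n powr (1 / real n)) \<longlonglongrightarrow> L" and "L < r" and r: "0 < r"
  obtains C where "0 < C" "\<And>n. a n \<le> C * r ^ n"
proof -
  have "\<forall>\<^sub>F n in sequentially. a n powr (1 / real n) < r"
    using lim \<open>L < r\<close> by (rule order_tendstoD)
  then obtain k where k: "\<And>n. n \<ge> k \<Longrightarrow> a n powr (1 / real n) < r"
    unfolding eventually_sequentially by blast
  \<comment> \<open>The sum dominates each ratio up to \<open>k\<close>; the summand 1 gives
    \<open>1 \<le> C\<close>, which covers the tail.\<close>
  define C where "C = 1 + (\<Sum>n\<le>k. a n / r ^ n)"
  have pos: "0 \<le> (\<Sum>n\<le>k. a n / r ^ n)"
    using nonneg r by (intro sum_nonneg) auto
  have "a n \<le> C * r ^ n" for n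
  proof (cases "n \<le> k")
    case True
    then have "a n / r ^ n \<le> (\<Sum>n\<le>k. a n / r ^ n)"
      using nonneg r by (intro member_le_sum) auto
    then have "a n / r ^ n \<le> C" unfolding C_def by simp
    then show ?thesis using r by (simp add: field_simps)
  next
    case False
    then have "a n \<le> r ^ n"
      using k[of n] nonneg by (intro le_power_if_powr_inverse_le) auto
    also have "\<dots> \<le> C * r ^ n"
      using pos r unfolding C_def by (simp add: distrib_right)
    finally show ?thesis .
  qed
  moreover have "0 < C" using pos unfolding C_def by simp
  ultimately show ?thesis using that by blast
qed

text \<open>Every \<open>r\<close> above \<open>B\<close> bounds \<open>b\<close>, hence
  \<open>a\<close>, geometrically, so \<open>A \<le> r\<close>; then let \<open>r\<close> decrease
  to \<open>B\<close>.\<close>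

lemma limit_le_limit_if_le_mult:
  fixes a b :: "nat \<Rightarrow> real"
  assumes "\<And>n. 0 \<le> a n" "\<And>n. 0 \<le> b n" "0 < C" "\<And>n. a n \<le> C * b n"
    and "(\<lambda>n. a n powr (1 / real n)) \<longlonglongrightarrow> A" and limb: "(\<lambda>n. b n powr (1 / real n)) \<longlonglongrightarrow> B"
  shows "A \<le> B"
proof (rule dense_ge)
  fix r assume "B < r"
  moreover have "0 \<le> B" by (rule LIMSEQ_le_const[OF limb]) simp
  ultimately have "0 < r" by simp
  then obtain D where D: "0 < D" "\<And>n. b n \<le> D * r ^ n"
    using le_geometric_if_limit_less[of b B r] assms \<open>B < r\<close> by metis
  have "a n \<le> (C * D) * r ^ n" for n
    using order.trans[OF assms(4) mult_left_mono[OF D(2)[of n], of C]] \<open>0 < C\<close> by (simp add: ac_simps)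
  then show "A \<le> r"
    using assms(1,3,5) D(1) \<open>0 < r\<close> by (intro limit_le_if_le_geometric[of a "C * D" r]) auto
qed

lemma submultiplicative_power_bound:
  fixes a :: "nat \<Rightarrow> real"
  assumes nonneg: "\<And>n. 0 \<le> a n" and sub: "\<And>m n. a (m + n) \<le> a m * a n"
  shows "a (q * n + s) \<le> a n ^ q * a s"
proof (induction q)
  case (Suc q)
  have "a (Suc q * n + s) = a (n + (q * n + s))" by (simp add: add.assoc)
  also have "\<dots> \<le> a n * a (q * n + s)" by (rule sub)
  also have "\<dots> \<le> a n * (a n ^ q * a s)" using Suc nonneg by (intro mult_left_mono)
  finally show ?case by (simp add: ac_simps)
qed simp

text \<open>Fekete's lemma in multiplicative form: the limit is the infimum of the roots. That each
  single root bounds the limit from above is recorded too, since the mixing criterion draws its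
  strict inequality from one such root.\<close>

lemma fekete_root_LIMSEQ:
  fixes a :: "nat \<Rightarrow> real"
  assumes nonneg: "\<And>n. 0 \<le> a n" and sub: "\<And>m n. a (m + n) \<le> a m * a n"
  obtains L where "(\<lambda>n. a n powr (1 / real n)) \<longlonglongrightarrow> L"
    "\<And>n. 1 \<le> n \<Longrightarrow> L \<le> a n powr (1 / real n)"
proof -
  define f where "f n = a n powr (1 / real n)" for n
  \<comment> \<open>Index 0 is excluded: there the exponent \<open>1 / real 0\<close> equals 0, so
    \<open>f 0\<close> is not a root.\<close>
  define L where "L = Inf (f ` {1..})"
  have f0: "0 \<le> f n" for n by (simp add: f_def)
  have bdd: "bdd_below (f ` {1..})" by (rule bdd_belowI2[of _ 0]) (use f0 in auto)
  have low: "L \<le> f n" if "1 \<le> n" for n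
    unfolding L_def using that bdd by (intro cInf_lower) auto
  have L0: "0 \<le> L"
    unfolding L_def by (rule cInf_greatest) (use f0 in auto)
  have "f \<longlonglongrightarrow> L"
  proof (rule order_tendstoI)
    fix y assume "y < L"
    then show "\<forall>\<^sub>F n in sequentially. y < f n"
      using low by (intro eventually_sequentiallyI[of 1]) (auto intro: less_le_trans)
  next
    fix y assume "L < y"
    then obtain r where r: "L < r" "r < y" using dense by blast
    have "\<exists>z\<in>f ` {1..}. z < r"
      using r(1) bdd unfolding L_def by (subst (asm) cInf_less_iff) auto
    then obtain k where k: "1 \<le> k" "f k < r" by auto
    have "0 < r" using L0 r by simp
    have ak: "a k \<le> r ^ k"
      using k nonneg by (intro le_power_if_powr_inverse_le) (auto simp: f_def)
    \<comment> \<open>Writing \<open>n = q * k + s\<close> with \<open>s < k\<close>, the factor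
      \<open>a k ^ q\<close> is at most \<open>r ^ (k * q)\<close>; this constant takes care of all
      remainders \<open>s\<close> at once.\<close>
    define C where "C = 1 + (\<Sum>s<k. a s / r ^ s)"
    have pos: "0 \<le> (\<Sum>s<k. a s / r ^ s)"
      using nonneg \<open>0 < r\<close> by (intro sum_nonneg) auto
    have "0 < C" using pos unfolding C_def by simp
    have bound: "a n \<le> C * r ^ n" for n
    proof -
      let ?q = "n div k" and ?s = "n mod k"
      have "?s < k" using k by simp
      then have "a ?s / r ^ ?s \<le> (\<Sum>s<k. a s / r ^ s)"
        using nonneg \<open>0 < r\<close> by (intro member_le_sum) auto
      then have "a ?s / r ^ ?s \<le> C" unfolding C_def by simp
      then have as: "a ?s \<le> C * r ^ ?s" using \<open>0 < r\<close> by (simp add: field_simps)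
      have "a n = a (?q * k + ?s)" by simp
      also have "\<dots> \<le> a k ^ ?q * a ?s"
        using nonneg sub by (rule submultiplicative_power_bound)
      also have "\<dots> \<le> (r ^ k) ^ ?q * (C * r ^ ?s)"
        using ak as nonneg \<open>0 < r\<close> by (intro mult_mono power_mono) auto
      also have "\<dots> = C * r ^ (?q * k + ?s)"
        by (simp only: power_add power_mult mult.commute[of "?q" k] ac_simps)
      finally show ?thesis by simp
    qed
    have "(\<lambda>n. C powr (1 / real n) * r) \<longlonglongrightarrow> 1 * r"
      by (intro tendsto_mult const_powr_inverse_LIMSEQ tendsto_const \<open>0 < C\<close>)
    then have "\<forall>\<^sub>F n in sequentially. C powr (1 / real n) * r < y"
      using r by (intro order_tendstoD(2)) auto
    moreover have "f n \<le> C powr (1 / real n) * r" if "1 \<le> n" for n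
    proof -
      have "f n \<le> (C * r ^ n) powr (1 / real n)"
        using bound nonneg unfolding f_def by (intro powr_mono2) auto
      also have "\<dots> = C powr (1 / real n) * r"
        using \<open>0 < r\<close> \<open>0 < C\<close> that by (simp add: powr_mult powr_powr flip: powr_realpow)
      finally show ?thesis .
    qed
    then have "\<forall>\<^sub>F n in sequentially. f n \<le> C powr (1 / real n) * r"
      by (rule eventually_sequentiallyI)
    ultimately show "\<forall>\<^sub>F n in sequentially. f n < y"
      by eventually_elim simp
  qed
  then show ?thesis using that low unfolding f_def by blast
qed

section \<open>The Frobenius norm\<close>

lemma mat_norm_nonneg: "0 \<le> mat_norm A"
  unfolding mat_norm_def by (simp add: sum_nonneg)

lemma mat_norm_entry_le:
  assumes "i < dim_row A" "j < dim_col A"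
  shows "cmod (A $$ (i, j)) \<le> mat_norm A"
proof -
  have "(cmod (A $$ (i, j)))\<^sup>2 \<le> (\<Sum>j<dim_col A. (cmod (A $$ (i, j)))\<^sup>2)"
    using assms by (intro member_le_sum) auto
  also have "\<dots> \<le> (\<Sum>i<dim_row A. \<Sum>j<dim_col A. (cmod (A $$ (i, j)))\<^sup>2)"
    using assms by (intro member_le_sum[of i "{..<dim_row A}" "\<lambda>i. \<Sum>j<dim_col A. (cmod (A $$ (i, j)))\<^sup>2"])
      (auto intro: sum_nonneg)
  finally show ?thesis unfolding mat_norm_def by (intro real_le_rsqrt)
qed

lemma mat_norm_le:
  assumes "A \<in> carrier_mat n n" "\<And>i j. i < n \<Longrightarrow> j < n \<Longrightarrow> cmod (A $$ (i, j)) \<le> K"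
  shows "mat_norm A \<le> real n * K"
proof (cases "n = 0")
  \<comment> \<open>For \<open>n = 0\<close> nothing forces \<open>K\<close> to be nonnegative, so
    the empty matrix is treated apart.\<close>
  case True
  then show ?thesis using assms unfolding mat_norm_def by auto
next
  case False
  then have "0 \<le> K" using assms(2)[of 0 0] by (meson norm_ge_zero order.trans neq0_conv)
  have "(\<Sum>i<n. \<Sum>j<n. (cmod (A $$ (i, j)))\<^sup>2) \<le> (\<Sum>i<n. \<Sum>j<n. K\<^sup>2)"
    using assms by (intro sum_mono power_mono) auto
  also have "\<dots> = (real n * K)\<^sup>2" by (simp add: power2_eq_square)
  finally show ?thesis
    using assms(1) \<open>0 \<le> K\<close> unfolding mat_norm_def by (intro real_le_lsqrt) (auto intro!: sum_nonneg)
qed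

lemma cmod_sum_mult_le:
  fixes f g :: "nat \<Rightarrow> complex"
  shows "(cmod (\<Sum>k<n. f k * g k))\<^sup>2 \<le> (\<Sum>k<n. (cmod (f k))\<^sup>2) * (\<Sum>k<n. (cmod (g k))\<^sup>2)"
proof -
  have "cmod (\<Sum>k<n. f k * g k) \<le> (\<Sum>k<n. \<bar>cmod (f k)\<bar> * \<bar>cmod (g k)\<bar>)"
    by (rule order.trans[OF norm_sum]) (simp add: norm_mult)
  also have "\<dots> \<le> L2_set (\<lambda>k. cmod (f k)) {..<n} * L2_set (\<lambda>k. cmod (g k)) {..<n}"
    by (rule L2_set_mult_ineq)
  finally have "(cmod (\<Sum>k<n. f k * g k))\<^sup>2 \<le> (L2_set (\<lambda>k. cmod (f k)) {..<n} * L2_set (\<lambda>k. cmod (g k)) {..<n})\<^sup>2"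
    by (intro power_mono) auto
  then show ?thesis by (simp add: power_mult_distrib L2_set_def sum_nonneg)
qed

text \<open>Cauchy-Schwarz bounds each entry of the product by a row of \<open>A\<close> times a
  column of \<open>B\<close>; the resulting double sum factors.\<close>

lemma mat_norm_mult_le:
  assumes A: "A \<in> carrier_mat n n" and B: "B \<in> carrier_mat n n"
  shows "mat_norm (A * B) \<le> mat_norm A * mat_norm B"
proof -
  have "(\<Sum>i<n. \<Sum>j<n. (cmod ((A * B) $$ (i, j)))\<^sup>2)
      \<le> (\<Sum>i<n. \<Sum>j<n. (\<Sum>k<n. (cmod (A $$ (i, k)))\<^sup>2) * (\<Sum>k<n. (cmod (B $$ (k, j)))\<^sup>2))"
  proof (intro sum_mono)
    fix i j assume "i \<in> {..<n}" "j \<in> {..<n}"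
    then have "(A * B) $$ (i, j) = (\<Sum>k<n. A $$ (i, k) * B $$ (k, j))"
      using A B by (auto simp: scalar_prod_def lessThan_atLeast0)
    then show "(cmod ((A * B) $$ (i, j)))\<^sup>2
        \<le> (\<Sum>k<n. (cmod (A $$ (i, k)))\<^sup>2) * (\<Sum>k<n. (cmod (B $$ (k, j)))\<^sup>2)"
      by (simp add: cmod_sum_mult_le)
  qed
  also have "\<dots> = (\<Sum>i<n. \<Sum>k<n. (cmod (A $$ (i, k)))\<^sup>2) * (\<Sum>j<n. \<Sum>k<n. (cmod (B $$ (k, j)))\<^sup>2)"
    by (simp add: sum_product)
  also have "(\<Sum>j<n. \<Sum>k<n. (cmod (B $$ (k, j)))\<^sup>2) = (\<Sum>k<n. \<Sum>j<n. (cmod (B $$ (k, j)))\<^sup>2)"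
    by (rule sum.swap)
  finally show ?thesis
    using A B unfolding mat_norm_def by (auto simp flip: real_sqrt_mult)
qed

section \<open>Words, matrix products along words, and the joint spectral radius\<close>

lemma finite_words: "finite (words m N)"
proof -
  have "words m N = {w. set w \<subseteq> {1..m} \<and> length w = N}" unfolding words_def by auto
  then show ?thesis by (simp add: finite_lists_length_eq)
qed

lemma words_nonempty: "1 \<le> m \<Longrightarrow> words m N \<noteq> {}"
  unfolding words_def by (auto intro!: exI[of _ "replicate N 1"])

lemma words_append_split:
  assumes "w \<in> words m (M + N)"
  obtains w1 w2 where "w = w1 @ w2" "w1 \<in> words m M" "w2 \<in> words m N"
proof
  show "w = take M w @ drop M w" by simp
  show "take M w \<in> words m M" "drop M w \<in> words m N"
    using assms set_take_subset[of M w] set_drop_subset[of M w] by (auto simp: words_def)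
qed

lemma word_prod_Nil: "word_prod n A [] = 1\<^sub>m n"
  and word_prod_Cons: "word_prod n A (a # w) = A a * word_prod n A w"
  by (simp_all add: word_prod_def)

lemma word_prod_carrier:
  assumes "\<And>i. A i \<in> carrier_mat n n"
  shows "word_prod n A w \<in> carrier_mat n n"
  by (induction w) (auto simp: word_prod_Nil word_prod_Cons intro: mult_carrier_mat assms)

lemma word_prod_append:
  assumes "\<And>i. A i \<in> carrier_mat n n"
  shows "word_prod n A (w1 @ w2) = word_prod n A w1 * word_prod n A w2"
  by (induction w1)
    (auto simp: word_prod_Nil word_prod_Cons left_mult_one_mat[OF word_prod_carrier[OF assms]]
      assoc_mult_mat[OF assms word_prod_carrier[OF assms] word_prod_carrier[OF assms]])

definition max_word_norm :: "nat \<Rightarrow> nat \<Rightarrow> (nat \<Rightarrow> complex mat) \<Rightarrow> nat \<Rightarrow> real" where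
  "max_word_norm n m A N = Max {mat_norm (word_prod n A w) | w. w \<in> words m N}"

lemma mat_norm_le_max_word_norm:
  "w \<in> words m N \<Longrightarrow> mat_norm (word_prod n A w) \<le> max_word_norm n m A N"
  unfolding max_word_norm_def using finite_words by (intro Max_ge) auto

lemma max_word_norm_attained:
  assumes "1 \<le> m"
  obtains w where "w \<in> words m N" "max_word_norm n m A N = mat_norm (word_prod n A w)"
proof -
  have "max_word_norm n m A N \<in> {mat_norm (word_prod n A w) | w. w \<in> words m N}"
    unfolding max_word_norm_def using finite_words words_nonempty[OF assms]
    by (intro Max_in) auto
  then show ?thesis using that by blast
qed

lemma max_word_norm_nonneg: "1 \<le> m \<Longrightarrow> 0 \<le> max_word_norm n m A N"
  by (metis max_word_norm_attained mat_norm_nonneg)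

text \<open>\<open>jsr\<close> is defined through \<open>lim\<close>, which is informative only once
  convergence is known. Cutting a maximizing word in two makes the maximal norms submultiplicative,
  and Fekete's lemma applies.\<close>

lemma jsr_LIMSEQ:
  assumes A: "\<And>i. A i \<in> carrier_mat n n" and m: "1 \<le> m"
  shows "(\<lambda>N. max_word_norm n m A N powr (1 / real N)) \<longlonglongrightarrow> jsr n m A"
proof -
  have "max_word_norm n m A (M + N) \<le> max_word_norm n m A M * max_word_norm n m A N" for M N
  proof -
    obtain w where w: "w \<in> words m (M + N)"
      "max_word_norm n m A (M + N) = mat_norm (word_prod n A w)"
      using max_word_norm_attained[OF m] .
    from w(1) obtain w1 w2 where s: "w = w1 @ w2" "w1 \<in> words m M" "w2 \<in> words m N"
      by (rule words_append_split)
    have "mat_norm (word_prod n A w) \<le> mat_norm (word_prod n A w1) * mat_norm (word_prod n A w2)"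
      unfolding s(1) word_prod_append[of A n, OF A]
      by (rule mat_norm_mult_le[of _ n]) (rule word_prod_carrier, rule A)+
    also have "\<dots> \<le> max_word_norm n m A M * max_word_norm n m A N"
      by (intro mult_mono mat_norm_le_max_word_norm s mat_norm_nonneg max_word_norm_nonneg m)
    finally show ?thesis using w(2) by simp
  qed
  from fekete_root_LIMSEQ[OF max_word_norm_nonneg[OF m] this]
  have "convergent (\<lambda>N. max_word_norm n m A N powr (1 / real N))"
    by (metis convergentI)
  then show ?thesis
    unfolding jsr_def max_word_norm_def[symmetric] by (simp add: convergent_LIMSEQ_iff)
qed

section \<open>The walk on a homogeneous space\<close>

text \<open>The setting of the theorem. Only the letters \<open>1..m\<close> carry probability
  distributions, hence the side condition \<open>set w \<subseteq> {1..m}\<close> wherever total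
  mass 1 matters.\<close>

locale homogeneous_walk = transitive_action G X \<phi>
  for G (structure) and X and \<phi> +
  fixes m :: nat and Q :: "nat \<Rightarrow> 'a \<Rightarrow> real"
  assumes finite_group: "finite (carrier G)" and finite_space: "finite X"
    and nonempty_space: "X \<noteq> {}" and one_le_m: "1 \<le> m"
    and prob_dist_Q: "\<And>i. i \<in> {1..m} \<Longrightarrow> prob_dist G (Q i)"
begin

sublocale group G
  using group_hom group_hom.axioms(1) by blast

lemma card_space_pos: "0 < real (card X)"
  using finite_space nonempty_space by (simp add: card_gt_0_iff)

lemma action_closed: "g \<in> carrier G \<Longrightarrow> x \<in> X \<Longrightarrow> \<phi> g x \<in> X"
  using element_image by blast

lemma action_inv_left: "g \<in> carrier G \<Longrightarrow> x \<in> X \<Longrightarrow> \<phi> (inv g) (\<phi> g x) = x"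
  using orbit_sym_aux by blast

lemma action_inv_right: "g \<in> carrier G \<Longrightarrow> x \<in> X \<Longrightarrow> \<phi> g (\<phi> (inv g) x) = x"
  using action_inv_left[of "inv g"] by simp

lemma action_one: "x \<in> X \<Longrightarrow> \<phi> \<one> x = x"
  using id_eq_one by (metis restrict_apply')

lemma action_eq_iff:
  "g \<in> carrier G \<Longrightarrow> x \<in> X \<Longrightarrow> y \<in> X \<Longrightarrow> \<phi> g x = y \<longleftrightarrow> x = \<phi> (inv g) y"
  using action_inv_left action_inv_right by metis

lemma sum_action_inv:
  "g \<in> carrier G \<Longrightarrow> (\<Sum>x\<in>X. f (\<phi> (inv g) x)) = (\<Sum>x\<in>X. f x)"
  by (rule sum.reindex_bij_witness[where i = "\<phi> g" and j = "\<phi> (inv g)"])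
    (auto simp: action_inv_left action_inv_right action_closed)

section \<open>Words acting on functions on the space\<close>

lemma act_point_eq:
  "act_point G \<phi> P x0 x = (\<Sum>g\<in>carrier G. if \<phi> g x0 = x then P g else 0)"
  unfolding act_point_def by (rule sum.inter_filter[OF finite_group])

text \<open>Convolution corresponds to composition: first move by \<open>R\<close>, then by
  \<open>P\<close>, which pulls the target \<open>x\<close> back by \<open>k\<close>.\<close>

lemma act_point_conv:
  assumes x0: "x0 \<in> X" and x: "x \<in> X"
  shows "act_point G \<phi> (conv G P R) x0 x = (\<Sum>k\<in>carrier G. P k * act_point G \<phi> R x0 (\<phi> (inv k) x))"
proof -
  have "act_point G \<phi> (conv G P R) x0 x
      = (\<Sum>h\<in>carrier G. \<Sum>g\<in>carrier G. if \<phi> h x0 = x then P (h \<otimes> inv g) * R g else 0)"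
    unfolding act_point_eq conv_def by (intro sum.cong) auto
  also have "\<dots> = (\<Sum>g\<in>carrier G. \<Sum>h\<in>carrier G. if \<phi> h x0 = x then P (h \<otimes> inv g) * R g else 0)"
    by (rule sum.swap)
  \<comment> \<open>For fixed \<open>g\<close>, substitute \<open>h = k \<otimes> g\<close>.\<close>
  also have "\<dots> = (\<Sum>g\<in>carrier G. \<Sum>k\<in>carrier G. if \<phi> (k \<otimes> g) x0 = x then P k * R g else 0)"
  proof (rule sum.cong[OF refl])
    fix g assume g: "g \<in> carrier G"
    show "(\<Sum>h\<in>carrier G. if \<phi> h x0 = x then P (h \<otimes> inv g) * R g else 0)
        = (\<Sum>k\<in>carrier G. if \<phi> (k \<otimes> g) x0 = x then P k * R g else 0)"
      using g by (intro sum.reindex_bij_witness[where i = "\<lambda>k. k \<otimes> g" and j = "\<lambda>h. h \<otimes> inv g"])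
        (auto simp: m_assoc)
  qed
  also have "\<dots> = (\<Sum>k\<in>carrier G. \<Sum>g\<in>carrier G. if \<phi> (k \<otimes> g) x0 = x then P k * R g else 0)"
    by (rule sum.swap)
  also have "\<dots> = (\<Sum>k\<in>carrier G. P k * act_point G \<phi> R x0 (\<phi> (inv k) x))"
    unfolding act_point_eq sum_distrib_left
    by (intro sum.cong refl)
      (auto simp: composition_rule x0 x action_eq_iff[OF _ action_closed[OF _ x0] x])
  finally show ?thesis .
qed

abbreviation trans_prob :: "nat list \<Rightarrow> 'c \<Rightarrow> 'c \<Rightarrow> real" where
  "trans_prob w \<equiv> act_point G \<phi> (conv_word G Q w)"

lemma trans_prob_Nil: "x0 \<in> X \<Longrightarrow> trans_prob [] x0 x = (if x0 = x then 1 else 0)"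
proof -
  assume "x0 \<in> X"
  have "trans_prob [] x0 x = (\<Sum>g\<in>carrier G. if g = \<one> then (if \<phi> g x0 = x then 1 else 0) else 0)"
    unfolding act_point_eq by (intro sum.cong) auto
  then show ?thesis using finite_group \<open>x0 \<in> X\<close> by (simp add: action_one)
qed

text \<open>The action of \<open>q\<^sup>(\<^sup>w\<^sup>)\<close> on complex functions on \<open>X\<close>.\<close>

definition walk :: "nat list \<Rightarrow> ('c \<Rightarrow> complex) \<Rightarrow> 'c \<Rightarrow> complex" where
  "walk w u x = (\<Sum>x0\<in>X. u x0 * complex_of_real (trans_prob w x0 x))"

lemma walk_Nil: "x \<in> X \<Longrightarrow> walk [] u x = u x"
proof -
  assume "x \<in> X"
  have "walk [] u x = (\<Sum>x0\<in>X. if x0 = x then u x0 else 0)"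
    unfolding walk_def by (intro sum.cong) (auto simp: trans_prob_Nil simp del: conv_word.simps)
  then show ?thesis using finite_space \<open>x \<in> X\<close> by simp
qed

text \<open>One more letter averages translates of the previous function. This recursion drives the
  inductions over words below.\<close>

lemma walk_Cons:
  assumes "x \<in> X"
  shows "walk (a # w) u x = (\<Sum>k\<in>carrier G. complex_of_real (Q a k) * walk w u (\<phi> (inv k) x))"
proof -
  have "walk (a # w) u x
      = (\<Sum>x0\<in>X. \<Sum>k\<in>carrier G. complex_of_real (Q a k)
          * (u x0 * complex_of_real (trans_prob w x0 (\<phi> (inv k) x))))"
    unfolding walk_def
    by (intro sum.cong refl) (simp add: act_point_conv assms sum_distrib_left mult.left_commute)
  also have "\<dots> = (\<Sum>k\<in>carrier G. \<Sum>x0\<in>X. complex_of_real (Q a k)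
          * (u x0 * complex_of_real (trans_prob w x0 (\<phi> (inv k) x))))"
    by (rule sum.swap)
  finally show ?thesis by (simp add: walk_def sum_distrib_left)
qed

lemma walk_cong: "(\<And>x. x \<in> X \<Longrightarrow> u x = v x) \<Longrightarrow> walk w u = walk w v"
  unfolding walk_def by auto

lemma walk_add: "walk w (\<lambda>x. u x + v x) x = walk w u x + walk w v x"
  by (simp add: walk_def distrib_right sum.distrib)

lemma walk_diff: "walk w (\<lambda>x. u x - v x) x = walk w u x - walk w v x"
  by (simp add: walk_def left_diff_distrib sum_subtractf)

lemma sum_Q: "a \<in> {1..m} \<Longrightarrow> (\<Sum>k\<in>carrier G. complex_of_real (Q a k)) = 1"
  using prob_dist_Q[of a] unfolding prob_dist_def by (metis of_real_1 of_real_sum)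

text \<open>Constants are stationary since translates of a constant agree and the weights
  \<open>Q a\<close> sum to 1. Hence centering a point mass is compatible with the walk.\<close>

lemma walk_const: "set w \<subseteq> {1..m} \<Longrightarrow> x \<in> X \<Longrightarrow> walk w (\<lambda>_. c) x = c"
proof (induction w arbitrary: x)
  case Nil
  then show ?case by (simp add: walk_Nil)
next
  case (Cons a w)
  then have "walk (a # w) (\<lambda>_. c) x = (\<Sum>k\<in>carrier G. complex_of_real (Q a k) * c)"
    by (simp add: walk_Cons action_closed)
  also have "\<dots> = c" using Cons sum_Q[of a] by (simp flip: sum_distrib_right)
  finally show ?case .
qed

text \<open>The group permutes \<open>X\<close>, so total mass is preserved; in particular the walk
  maps functions of sum zero to functions of sum zero.\<close>

lemma sum_walk: "set w \<subseteq> {1..m} \<Longrightarrow> (\<Sum>x\<in>X. walk w u x) = (\<Sum>x\<in>X. u x)"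
proof (induction w)
  case Nil
  then show ?case by (simp add: walk_Nil)
next
  case (Cons a w)
  have "(\<Sum>x\<in>X. walk (a # w) u x)
      = (\<Sum>k\<in>carrier G. \<Sum>x\<in>X. complex_of_real (Q a k) * walk w u (\<phi> (inv k) x))"
    by (simp add: walk_Cons sum.swap[of _ "carrier G" X])
  also have "\<dots> = (\<Sum>k\<in>carrier G. complex_of_real (Q a k) * (\<Sum>x\<in>X. walk w u x))"
    by (intro sum.cong refl) (simp add: sum_action_inv flip: sum_distrib_left)
  also have "\<dots> = (\<Sum>x\<in>X. walk w u x)"
    using Cons sum_Q[of a] by (simp flip: sum_distrib_right)
  finally show ?case using Cons by simp
qed

lemma walk_append: "x \<in> X \<Longrightarrow> walk (w1 @ w2) u x = walk w1 (walk w2 u) x"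
proof (induction w1 arbitrary: x)
  case Nil
  then show ?case by (simp add: walk_Nil)
next
  case (Cons a w)
  then show ?case by (simp add: walk_Cons action_closed)
qed

section \<open>Total variation distance and its submultiplicativity\<close>

definition deviation :: "nat list \<Rightarrow> 'c \<Rightarrow> 'c \<Rightarrow> complex" where
  "deviation w x0 x = complex_of_real (trans_prob w x0 x - 1 / real (card X))"

text \<open>The point mass at \<open>x0\<close> minus the uniform distribution. The value 0 off
  \<open>X\<close> makes it an element of the function subspaces used later.\<close>

definition centered_point :: "'c \<Rightarrow> 'c \<Rightarrow> complex" where
  "centered_point x0 x = (if x \<in> X then (if x = x0 then 1 else 0) - complex_of_real (1 / real (card X)) else 0)"

lemma walk_centered_point:
  assumes "set w \<subseteq> {1..m}" "x0 \<in> X" "x \<in> X"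
  shows "walk w (centered_point x0) x = deviation w x0 x"
proof -
  have "walk w (centered_point x0) x
      = walk w (\<lambda>y. (if y = x0 then 1 else 0) - complex_of_real (1 / real (card X))) x"
    by (intro fun_cong[OF walk_cong]) (simp add: centered_point_def)
  also have "\<dots> = walk w (\<lambda>y. if y = x0 then 1 else 0) x - complex_of_real (1 / real (card X))"
    by (simp only: walk_diff walk_const assms)
  also have "walk w (\<lambda>y. if y = x0 then 1 else 0) x
      = (\<Sum>y\<in>X. if y = x0 then complex_of_real (trans_prob w y x) else 0)"
    unfolding walk_def by (intro sum.cong) auto
  also have "\<dots> = complex_of_real (trans_prob w x0 x)"
    using assms finite_space by simp
  finally show ?thesis by (simp add: deviation_def)
qed

lemma sum_centered_point: "x0 \<in> X \<Longrightarrow> (\<Sum>x\<in>X. centered_point x0 x) = 0"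
  using nonempty_space finite_space by (simp add: centered_point_def sum_subtractf)

lemma tv_to_uniform_eq:
  "tv_to_uniform G X \<phi> (conv_word G Q w) x0 = (\<Sum>x\<in>X. cmod (deviation w x0 x)) / 2"
  unfolding tv_to_uniform_def deviation_def norm_of_real by simp

abbreviation max_tv :: "nat \<Rightarrow> real" where
  "max_tv \<equiv> max_dist G X \<phi> m Q"

lemma finite_tv_values:
  "finite {tv_to_uniform G X \<phi> (conv_word G Q w) x0 | x0 w. x0 \<in> X \<and> w \<in> words m N}"
proof -
  have "{tv_to_uniform G X \<phi> (conv_word G Q w) x0 | x0 w. x0 \<in> X \<and> w \<in> words m N}
      = (\<lambda>(x0, w). tv_to_uniform G X \<phi> (conv_word G Q w) x0) ` (X \<times> words m N)"
    by auto
  then show ?thesis using finite_space finite_words by simp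
qed

lemma sum_deviation_le:
  assumes "x0 \<in> X" "w \<in> words m N"
  shows "(\<Sum>x\<in>X. cmod (deviation w x0 x)) \<le> 2 * max_tv N"
proof -
  have "tv_to_uniform G X \<phi> (conv_word G Q w) x0 \<le> max_tv N"
    unfolding max_dist_def using finite_tv_values assms by (intro Max_ge) auto
  then show ?thesis by (simp add: tv_to_uniform_eq)
qed

lemma max_tv_attained:
  obtains x0 w where "x0 \<in> X" "w \<in> words m N" "2 * max_tv N = (\<Sum>x\<in>X. cmod (deviation w x0 x))"
proof -
  have "max_tv N \<in> {tv_to_uniform G X \<phi> (conv_word G Q w) x0 | x0 w. x0 \<in> X \<and> w \<in> words m N}"
    unfolding max_dist_def using finite_tv_values words_nonempty[OF one_le_m] nonempty_space
    by (intro Max_in) blast+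
  then show ?thesis using that by (auto simp: tv_to_uniform_eq)
qed

lemma max_tv_nonneg: "0 \<le> max_tv N"
proof -
  obtain x0 w where "2 * max_tv N = (\<Sum>x\<in>X. cmod (deviation w x0 x))"
    by (rule max_tv_attained)
  then show ?thesis using sum_nonneg[of X "\<lambda>x. cmod (deviation w x0 x)"] by simp
qed

text \<open>On functions of sum zero the kernel may be replaced by \<open>deviation\<close>, whose
  l1 norm from each starting point is at most \<open>2 * max_tv N\<close>.\<close>

lemma sum_walk_le:
  assumes w: "w \<in> words m N" and u: "(\<Sum>x\<in>X. u x) = 0"
  shows "(\<Sum>x\<in>X. cmod (walk w u x)) \<le> (\<Sum>x\<in>X. cmod (u x)) * (2 * max_tv N)"
proof -
  \<comment> \<open>The two sides differ by the sum of \<open>u\<close> divided by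
    \<open>card X\<close>, which is 0.\<close>
  have "walk w u x = (\<Sum>y\<in>X. u y * deviation w y x)" for x
  proof -
    have "(\<Sum>y\<in>X. u y * deviation w y x)
        = walk w u x - (\<Sum>y\<in>X. u y) * complex_of_real (1 / real (card X))"
      by (simp only: walk_def deviation_def of_real_diff right_diff_distrib sum_subtractf sum_distrib_right)
    then show ?thesis using u by simp
  qed
  then have "(\<Sum>x\<in>X. cmod (walk w u x)) \<le> (\<Sum>x\<in>X. \<Sum>y\<in>X. cmod (u y) * cmod (deviation w y x))"
    by (auto intro!: sum_mono order.trans[OF norm_sum] simp: norm_mult)
  also have "\<dots> = (\<Sum>y\<in>X. cmod (u y) * (\<Sum>x\<in>X. cmod (deviation w y x)))"
    by (subst sum.swap) (simp add: sum_distrib_left)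
  also have "\<dots> \<le> (\<Sum>y\<in>X. cmod (u y) * (2 * max_tv N))"
    using w by (intro sum_mono mult_left_mono sum_deviation_le) auto
  finally show ?thesis by (simp add: sum_distrib_right)
qed

text \<open>The deviation of \<open>w1 @ w2\<close> is the walk along \<open>w1\<close> applied to
  the deviation of \<open>w2\<close>, a function of sum zero. The factor 2 turns total variation
  into the l1 norm, for which no extra constant appears.\<close>

lemma max_tv_submultiplicative: "2 * max_tv (M + N) \<le> (2 * max_tv M) * (2 * max_tv N)"
proof -
  obtain x0 w where x0: "x0 \<in> X" and w: "w \<in> words m (M + N)"
    and eq: "2 * max_tv (M + N) = (\<Sum>x\<in>X. cmod (deviation w x0 x))"
    by (rule max_tv_attained)
  obtain w1 w2 where s: "w = w1 @ w2" and w1: "w1 \<in> words m M" and w2: "w2 \<in> words m N"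
    using w by (rule words_append_split)
  have sets: "set w \<subseteq> {1..m}" "set w2 \<subseteq> {1..m}"
    using w w2 by (auto simp: words_def)
  have walk2: "walk w2 (centered_point x0) x = deviation w2 x0 x" if "x \<in> X" for x
    using sets x0 that by (intro walk_centered_point)
  have "deviation w x0 x = walk w1 (deviation w2 x0) x" if "x \<in> X" for x
  proof -
    have "deviation w x0 x = walk w1 (walk w2 (centered_point x0)) x"
      using that x0 sets by (simp add: walk_centered_point[symmetric] s walk_append)
    also have "\<dots> = walk w1 (deviation w2 x0) x"
      using walk2 by (intro fun_cong[OF walk_cong])
    finally show ?thesis .
  qed
  then have "2 * max_tv (M + N) = (\<Sum>x\<in>X. cmod (walk w1 (deviation w2 x0) x))"
    using eq by simp
  also have "\<dots> \<le> (\<Sum>x\<in>X. cmod (deviation w2 x0 x)) * (2 * max_tv M)"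
    using sum_walk[OF sets(2), of "centered_point x0"] sum_centered_point[OF x0] walk2 w1
    by (intro sum_walk_le) auto
  also have "\<dots> \<le> (2 * max_tv N) * (2 * max_tv M)"
    using x0 w2 max_tv_nonneg by (intro mult_right_mono sum_deviation_le) auto
  finally show ?thesis by (simp add: mult.commute)
qed

end

section \<open>Fourier matrices of subrepresentations\<close>

lemma mult_mat_vec_index:
  assumes "A \<in> carrier_mat n n" "v \<in> carrier_vec n" "i < n"
  shows "(A *\<^sub>v v) $ i = (\<Sum>j<n. A $$ (i, j) * v $ j)"
  using assms by (auto simp: scalar_prod_def lessThan_atLeast0)

lemma fourier_carrier: "fourier G n \<rho> P \<in> carrier_mat n n"
  by (simp add: fourier_def)

text \<open>With \<open>T v = \<Sum>i<n. v $ i * f i\<close>, injectivity makes the Gram matrix of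
  the \<open>f i\<close> invertible, and its inverse composed with the adjoint of \<open>T\<close>
  is a left inverse of \<open>T\<close>.\<close>

lemma injective_family_left_inverse:
  fixes f :: "nat \<Rightarrow> 'x \<Rightarrow> complex"
  assumes X: "finite X"
    and inj: "\<forall>v\<in>carrier_vec n. (\<forall>x\<in>X. (\<Sum>i<n. v $ i * f i x) = 0) \<longrightarrow> v = 0\<^sub>v n"
  shows "\<exists>B :: nat \<Rightarrow> 'x \<Rightarrow> complex. \<forall>v\<in>carrier_vec n. \<forall>j<n.
    v $ j = (\<Sum>x\<in>X. B j x * (\<Sum>i<n. v $ i * f i x))"
proof -
  define A where "A = mat n n (\<lambda>(i, j). \<Sum>x\<in>X. cnj (f i x) * f j x)"
  have A: "A \<in> carrier_mat n n" by (simp add: A_def)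
  have Av: "(A *\<^sub>v v) $ i = (\<Sum>x\<in>X. cnj (f i x) * (\<Sum>j<n. v $ j * f j x))"
    if v: "v \<in> carrier_vec n" and i: "i < n" for v i
  proof -
    have "(A *\<^sub>v v) $ i = (\<Sum>j<n. \<Sum>x\<in>X. cnj (f i x) * (v $ j * f j x))"
      unfolding mult_mat_vec_index[OF A v i] using i
      by (intro sum.cong refl) (simp add: A_def sum_distrib_right sum_distrib_left mult_ac)
    also have "\<dots> = (\<Sum>x\<in>X. \<Sum>j<n. cnj (f i x) * (v $ j * f j x))" by (rule sum.swap)
    finally show ?thesis by (simp add: sum_distrib_left)
  qed
  have "v = 0\<^sub>v n" if v: "v \<in> carrier_vec n" and zero: "A *\<^sub>v v = 0\<^sub>v n" for v
  proof -
    define T where "T x = (\<Sum>j<n. v $ j * f j x)" for x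
    \<comment> \<open>Pairing \<open>A *\<^sub>v v\<close> with \<open>v\<close> gives the squared
      norm of \<open>T\<close>, so \<open>T\<close> vanishes on \<open>X\<close>.\<close>
    have "0 = (\<Sum>i<n. cnj (v $ i) * (A *\<^sub>v v) $ i)" by (simp add: zero)
    also have "\<dots> = (\<Sum>i<n. \<Sum>x\<in>X. cnj (v $ i * f i x) * T x)"
      using v by (intro sum.cong refl) (simp add: Av T_def sum_distrib_left mult_ac)
    also have "\<dots> = (\<Sum>x\<in>X. cnj (T x) * T x)"
      by (subst sum.swap) (simp add: T_def sum_distrib_right)
    also have "\<dots> = complex_of_real (\<Sum>x\<in>X. (cmod (T x))\<^sup>2)"
      unfolding of_real_sum complex_norm_square by (simp add: mult.commute)
    finally have "complex_of_real (\<Sum>x\<in>X. (cmod (T x))\<^sup>2) = 0" by (rule sym)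
    then have "(\<Sum>x\<in>X. (cmod (T x))\<^sup>2) = 0" by (simp only: of_real_eq_0_iff)
    then have "\<forall>x\<in>X. (\<Sum>j<n. v $ j * f j x) = 0"
      using X by (simp add: sum_nonneg_eq_0_iff T_def)
    then show ?thesis using inj v by blast
  qed
  then have "det A \<noteq> 0" using A det_0_iff_vec_prod_zero by blast
  then obtain C where C: "C \<in> carrier_mat n n" "C * A = 1\<^sub>m n"
    using det_non_zero_imp_unit[OF A, of "()"] unfolding Units_def ring_mat_def by auto
  define B where "B j x = (\<Sum>k<n. C $$ (j, k) * cnj (f k x))" for j x
  show ?thesis
  proof (intro exI[of _ B] ballI allI impI)
    fix v :: "complex vec" and j assume v: "v \<in> carrier_vec n" and j: "j < n"
    have "v = C *\<^sub>v (A *\<^sub>v v)"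
      using C v A by (simp flip: assoc_mult_mat_vec[OF C(1) A v])
    then have "v $ j = (C *\<^sub>v (A *\<^sub>v v)) $ j" by simp
    also have "\<dots> = (\<Sum>k<n. C $$ (j, k) * (A *\<^sub>v v) $ k)"
      using C A v j by (intro mult_mat_vec_index) auto
    also have "\<dots> = (\<Sum>k<n. \<Sum>x\<in>X. C $$ (j, k) * cnj (f k x) * (\<Sum>i<n. v $ i * f i x))"
      using v by (intro sum.cong refl) (simp add: Av sum_distrib_left mult.assoc)
    also have "\<dots> = (\<Sum>x\<in>X. B j x * (\<Sum>i<n. v $ i * f i x))"
      by (subst sum.swap) (simp add: B_def sum_distrib_right)
    finally show "v $ j = (\<Sum>x\<in>X. B j x * (\<Sum>i<n. v $ i * f i x))" .
  qed
qed

lemma smult_unit_vec_sum: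
  fixes c :: "nat \<Rightarrow> complex"
  assumes "j < n"
  shows "(\<Sum>i<n. (a \<cdot>\<^sub>v unit_vec n j) $ i * c i) = a * c j"
proof -
  have "(\<Sum>i<n. (a \<cdot>\<^sub>v unit_vec n j) $ i * c i) = (\<Sum>i<n. if i = j then a * c i else 0)"
    using assms by (intro sum.cong) auto
  then show ?thesis using assms by simp
qed

lemma unit_vec_sum:
  fixes c :: "nat \<Rightarrow> complex"
  shows "j < n \<Longrightarrow> (\<Sum>i<n. unit_vec n j $ i * c i) = c j"
  using smult_unit_vec_sum[of j n 1 c] by simp

section \<open>Equivariant embeddings and the upper bound for the joint spectral radii\<close>

context homogeneous_walk
begin

text \<open>The intertwining clause of \<open>appears_in\<close>, separated from injectivity because
  the comparison with the walk rests on this clause alone.\<close>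

definition equivariant :: "nat \<Rightarrow> ('a \<Rightarrow> complex mat) \<Rightarrow> (nat \<Rightarrow> 'c \<Rightarrow> complex) \<Rightarrow> bool" where
  "equivariant n \<rho> f \<longleftrightarrow> (\<forall>g\<in>carrier G. \<forall>v\<in>carrier_vec n. \<forall>x\<in>X.
     (\<Sum>i<n. (\<rho> g *\<^sub>v v) $ i * f i x) = (\<Sum>i<n. v $ i * f i (\<phi> (inv g) x)))"

abbreviation fourier_word :: "nat \<Rightarrow> ('a \<Rightarrow> complex mat) \<Rightarrow> nat list \<Rightarrow> complex mat" where
  "fourier_word n \<rho> \<equiv> word_prod n (\<lambda>i. fourier G n \<rho> (Q i))"

lemma fourier_word_carrier: "fourier_word n \<rho> w \<in> carrier_mat n n"
  by (rule word_prod_carrier) (rule fourier_carrier)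

lemma fourier_mult_vec_index:
  assumes \<rho>: "\<And>g. g \<in> carrier G \<Longrightarrow> \<rho> g \<in> carrier_mat n n"
    and u: "u \<in> carrier_vec n" and i: "i < n"
  shows "(fourier G n \<rho> P *\<^sub>v u) $ i = (\<Sum>g\<in>carrier G. complex_of_real (P g) * (\<rho> g *\<^sub>v u) $ i)"
proof -
  have "(fourier G n \<rho> P *\<^sub>v u) $ i
      = (\<Sum>j<n. \<Sum>g\<in>carrier G. complex_of_real (P g) * (\<rho> g $$ (i, j) * u $ j))"
    unfolding mult_mat_vec_index[OF fourier_carrier u i] using i
    by (intro sum.cong refl) (simp add: fourier_def sum_distrib_right mult.assoc)
  also have "\<dots> = (\<Sum>g\<in>carrier G. \<Sum>j<n. complex_of_real (P g) * (\<rho> g $$ (i, j) * u $ j))"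
    by (rule sum.swap)
  also have "\<dots> = (\<Sum>g\<in>carrier G. complex_of_real (P g) * (\<rho> g *\<^sub>v u) $ i)"
    using mult_mat_vec_index[OF \<rho> u i] by (intro sum.cong refl) (simp add: sum_distrib_left)
  finally show ?thesis .
qed

text \<open>A Fourier matrix is the \<open>Q a\<close>-average of the matrices
  \<open>\<rho> g\<close>, and equivariance turns each of these into a translation. So the embedding
  intertwines Fourier products with the walk.\<close>

lemma equivariant_walk:
  assumes \<rho>: "\<And>g. g \<in> carrier G \<Longrightarrow> \<rho> g \<in> carrier_mat n n" and f: "equivariant n \<rho> f"
    and v: "v \<in> carrier_vec n" and x: "x \<in> X"
  shows "(\<Sum>i<n. (fourier_word n \<rho> w *\<^sub>v v) $ i * f i x) = walk w (\<lambda>y. \<Sum>i<n. v $ i * f i y) x"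
  using x
proof (induction w arbitrary: x)
  case Nil
  then show ?case using v by (simp add: word_prod_Nil walk_Nil)
next
  case (Cons a w)
  define u where "u = fourier_word n \<rho> w *\<^sub>v v"
  have u: "u \<in> carrier_vec n" using fourier_word_carrier v unfolding u_def by (rule mult_mat_vec_carrier)
  have "fourier_word n \<rho> (a # w) *\<^sub>v v = fourier G n \<rho> (Q a) *\<^sub>v u"
    unfolding u_def word_prod_Cons by (rule assoc_mult_mat_vec[OF fourier_carrier fourier_word_carrier v])
  then have "(\<Sum>i<n. (fourier_word n \<rho> (a # w) *\<^sub>v v) $ i * f i x)
      = (\<Sum>i<n. \<Sum>g\<in>carrier G. complex_of_real (Q a g) * ((\<rho> g *\<^sub>v u) $ i * f i x))"
    by (intro sum.cong refl) (simp add: fourier_mult_vec_index[of \<rho>] \<rho> u sum_distrib_right mult.assoc)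
  also have "\<dots> = (\<Sum>g\<in>carrier G. \<Sum>i<n. complex_of_real (Q a g) * ((\<rho> g *\<^sub>v u) $ i * f i x))"
    by (rule sum.swap)
  also have "\<dots> = (\<Sum>g\<in>carrier G. complex_of_real (Q a g) * (\<Sum>i<n. u $ i * f i (\<phi> (inv g) x)))"
    using f u Cons.prems unfolding equivariant_def by (simp flip: sum_distrib_left)
  also have "\<dots> = walk (a # w) (\<lambda>y. \<Sum>i<n. v $ i * f i y) x"
    using Cons by (simp add: walk_Cons action_closed u_def)
  finally show ?case .
qed

text \<open>Summing the embedded function over \<open>X\<close> is a linear functional invariant
  under the group, so its kernel \<open>W\<close> is a subrepresentation. If \<open>W\<close> is
  zero, the functional is injective, which forces degree 1 and the trivial action; otherwise it
  vanishes identically.\<close>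

lemma sum_zero_if_nontrivial:
  assumes \<rho>: "\<And>g. g \<in> carrier G \<Longrightarrow> \<rho> g \<in> carrier_mat n n" and f: "equivariant n \<rho> f"
    and irr: "irreducible_rep G n \<rho>" and nontriv: "\<not> trivial_rep G n \<rho>" and j: "j < n"
  shows "(\<Sum>x\<in>X. f j x) = 0"
proof -
  define s where "s i = (\<Sum>x\<in>X. f i x)" for i
  define W where "W = {v \<in> carrier_vec n. (\<Sum>i<n. v $ i * s i) = 0}"
  have total: "(\<Sum>i<n. v $ i * s i) = (\<Sum>x\<in>X. \<Sum>i<n. v $ i * f i x)" for v
    unfolding s_def by (subst sum.swap) (simp add: sum_distrib_left)
  have inv: "(\<Sum>i<n. (\<rho> g *\<^sub>v v) $ i * s i) = (\<Sum>i<n. v $ i * s i)"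
    if "g \<in> carrier G" "v \<in> carrier_vec n" for g v
    using f that sum_action_inv[of g "\<lambda>x. \<Sum>i<n. v $ i * f i x"]
    unfolding total equivariant_def by simp
  have "subspace_vec n W"
    unfolding subspace_vec_def W_def
    by (auto simp: distrib_right sum.distrib mult.assoc simp flip: sum_distrib_left)
  moreover have "\<forall>g\<in>carrier G. \<forall>v\<in>W. \<rho> g *\<^sub>v v \<in> W"
    using inv mult_mat_vec_carrier[OF \<rho>] unfolding W_def by auto
  ultimately have "W = {0\<^sub>v n} \<or> W = carrier_vec n"
    using irr unfolding irreducible_rep_def by simp
  then consider "W = {0\<^sub>v n}" | "W = carrier_vec n" by blast
  then show ?thesis
  proof cases
    case 1
    have diff: "v = u" if "v \<in> carrier_vec n" "u \<in> carrier_vec n"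
      "(\<Sum>i<n. v $ i * s i) = (\<Sum>i<n. u $ i * s i)" for u v
    proof -
      have "v - u \<in> W"
        using that unfolding W_def by (auto simp: left_diff_distrib sum_subtractf)
      then have "v - u = 0\<^sub>v n" using 1 by simp
      then have "v $ i - u $ i = 0" if "i < n" for i
        using that \<open>u \<in> carrier_vec n\<close> by (metis carrier_vecD index_minus_vec(1) index_zero_vec(1))
      then show ?thesis using that by (intro eq_vecI) auto
    qed
    have "n = 1"
    proof (rule ccontr)
      assume "n \<noteq> 1"
      then have n: "0 < n" "1 < n" using j by auto
      \<comment> \<open>Both vectors have the value \<open>s 0 * s 1\<close> under the functional.
        Comparing coordinate 1 gives \<open>s 0 = 0\<close>, so the functional also kills
        \<open>unit_vec n 0\<close>, a contradiction.\<close>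
      have "s 1 \<cdot>\<^sub>v unit_vec n 0 = s 0 \<cdot>\<^sub>v unit_vec n 1"
        by (intro diff) (simp_all only: smult_unit_vec_sum n smult_carrier_vec unit_vec_carrier, rule mult.commute)
      from arg_cong[OF this, of "\<lambda>v. v $ 1"]
      have s0: "s 0 = 0" using n by simp
      have "unit_vec n 0 = (0\<^sub>v n :: complex vec)"
        by (intro diff) (simp_all only: unit_vec_sum n unit_vec_carrier zero_carrier_vec, simp add: s0)
      from arg_cong[OF this, of "\<lambda>v. v $ 0"] show False using n by simp
    qed
    moreover have "\<rho> g = 1\<^sub>m 1" if g: "g \<in> carrier G" for g
    proof -
      have "\<rho> g *\<^sub>v unit_vec n 0 = unit_vec n 0"
        by (intro diff inv g mult_mat_vec_carrier[OF \<rho>[OF g]] unit_vec_carrier)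
      then have "(\<rho> g *\<^sub>v unit_vec n 0) $ 0 = 1" using \<open>n = 1\<close> by simp
      then have "\<rho> g $$ (0, 0) = 1"
        using \<rho>[OF g] \<open>n = 1\<close> by (simp add: mult_mat_vec_index[of _ 1])
      then show ?thesis using \<rho>[OF g] \<open>n = 1\<close> by (intro eq_matI) auto
    qed
    ultimately have False using nontriv unfolding trivial_rep_def by simp
    then show ?thesis ..
  next
    case 2
    then have "unit_vec n j \<in> W" by simp
    then show ?thesis using j unit_vec_sum[of j n s] unfolding W_def s_def by simp
  qed
qed

text \<open>The left inverse \<open>B\<close> recovers each entry of the Fourier product from the
  walk started at some \<open>f j\<close>, and \<open>f j\<close> has sum zero, so
  \<open>sum_walk_le\<close> applies.\<close>

lemma fourier_word_norm_bound:
  assumes \<rho>: "\<And>g. g \<in> carrier G \<Longrightarrow> \<rho> g \<in> carrier_mat n n"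
    and irr: "irreducible_rep G n \<rho>" and nontriv: "\<not> trivial_rep G n \<rho>"
    and app: "appears_in G X \<phi> n \<rho>"
  obtains C where "0 < C" "\<And>N w. w \<in> words m N \<Longrightarrow> mat_norm (fourier_word n \<rho> w) \<le> C * (2 * max_tv N)"
proof -
  obtain f where inj: "\<forall>v\<in>carrier_vec n. (\<forall>x\<in>X. (\<Sum>i<n. v $ i * f i x) = 0) \<longrightarrow> v = 0\<^sub>v n"
    and f: "equivariant n \<rho> f"
    using app unfolding appears_in_def equivariant_def by (elim exE conjE)
  obtain B :: "nat \<Rightarrow> 'c \<Rightarrow> complex" where B: "\<forall>v\<in>carrier_vec n. \<forall>j<n.
      v $ j = (\<Sum>x\<in>X. B j x * (\<Sum>i<n. v $ i * f i x))"
    using injective_family_left_inverse[OF finite_space inj] by (elim exE)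
  define b where "b = (\<Sum>i<n. \<Sum>x\<in>X. cmod (B i x))"
  define c where "c = (\<Sum>j<n. \<Sum>x\<in>X. cmod (f j x))"
  have b0: "0 \<le> b" and c0: "0 \<le> c" unfolding b_def c_def by (simp_all add: sum_nonneg)
  have b: "cmod (B i x) \<le> b" if "i < n" "x \<in> X" for i x
  proof -
    have "cmod (B i x) \<le> (\<Sum>x\<in>X. cmod (B i x))"
      using that finite_space by (intro member_le_sum) auto
    also have "\<dots> \<le> b"
      unfolding b_def using that
      by (intro member_le_sum[of i "{..<n}" "\<lambda>i. \<Sum>x\<in>X. cmod (B i x)"]) (auto intro: sum_nonneg)
    finally show ?thesis .
  qed
  have c: "(\<Sum>x\<in>X. cmod (f j x)) \<le> c" if "j < n" for j
    unfolding c_def using that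
    by (intro member_le_sum[of j "{..<n}" "\<lambda>i. \<Sum>x\<in>X. cmod (f i x)"]) (auto intro: sum_nonneg)
  have entry: "cmod (fourier_word n \<rho> w $$ (i, j)) \<le> b * c * (2 * max_tv N)"
    if w: "w \<in> words m N" and ij: "i < n" "j < n" for w N i j
  proof -
    let ?W = "fourier_word n \<rho> w" and ?e = "unit_vec n j :: complex vec"
    have W: "?W *\<^sub>v ?e \<in> carrier_vec n"
      by (rule mult_mat_vec_carrier[OF fourier_word_carrier]) simp
    have "?W $$ (i, j) = (?W *\<^sub>v ?e) $ i"
      using unit_vec_sum[of j n "\<lambda>k. ?W $$ (i, k)"] ij
      by (simp add: mult_mat_vec_index[OF fourier_word_carrier] mult.commute del: index_unit_vec)
    also have "\<dots> = (\<Sum>x\<in>X. B i x * (\<Sum>k<n. (?W *\<^sub>v ?e) $ k * f k x))"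
      by (rule B[rule_format, OF W ij(1)])
    also have "\<dots> = (\<Sum>x\<in>X. B i x * walk w (f j) x)"
      using ij by (intro sum.cong refl) (simp add: equivariant_walk[OF \<rho> f] unit_vec_sum del: index_unit_vec)
    finally have "cmod (?W $$ (i, j)) \<le> (\<Sum>x\<in>X. cmod (B i x) * cmod (walk w (f j) x))"
      by (auto intro: order.trans[OF norm_sum] simp: norm_mult)
    also have "\<dots> \<le> (\<Sum>x\<in>X. b * cmod (walk w (f j) x))"
      using b ij by (intro sum_mono mult_right_mono) auto
    also have "\<dots> = b * (\<Sum>x\<in>X. cmod (walk w (f j) x))" by (simp add: sum_distrib_left)
    also have "\<dots> \<le> b * ((\<Sum>x\<in>X. cmod (f j x)) * (2 * max_tv N))"
      using b0 by (intro mult_left_mono sum_walk_le w sum_zero_if_nontrivial[OF \<rho> f irr nontriv] ij)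
    also have "\<dots> \<le> b * (c * (2 * max_tv N))"
      using b0 c[OF ij(2)] max_tv_nonneg by (intro mult_left_mono mult_right_mono) auto
    finally show ?thesis by (simp add: mult.assoc)
  qed
  \<comment> \<open>The summand 1 only ensures that the constant is positive.\<close>
  have "mat_norm (fourier_word n \<rho> w) \<le> (real n * (b * c) + 1) * (2 * max_tv N)"
    if w: "w \<in> words m N" for w N
  proof -
    have "mat_norm (fourier_word n \<rho> w) \<le> real n * (b * c * (2 * max_tv N))"
      by (intro mat_norm_le fourier_word_carrier entry w)
    also have "\<dots> \<le> (real n * (b * c) + 1) * (2 * max_tv N)"
      using max_tv_nonneg[of N] by (simp add: algebra_simps)
    finally show ?thesis .
  qed
  moreover have "0 < real n * (b * c) + 1" using b0 c0 by (simp add: add_nonneg_pos)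
  ultimately show ?thesis using that by blast
qed

lemma jsr_le_max_tv_limit:
  assumes \<rho>: "\<And>g. g \<in> carrier G \<Longrightarrow> \<rho> g \<in> carrier_mat n n"
    and "irreducible_rep G n \<rho>" "\<not> trivial_rep G n \<rho>" "appears_in G X \<phi> n \<rho>"
    and lim: "(\<lambda>N. (2 * max_tv N) powr (1 / real N)) \<longlonglongrightarrow> L"
  shows "jsr n m (\<lambda>i. fourier G n \<rho> (Q i)) \<le> L"
proof -
  obtain C where C: "0 < C"
    "\<And>N w. w \<in> words m N \<Longrightarrow> mat_norm (fourier_word n \<rho> w) \<le> C * (2 * max_tv N)"
    using fourier_word_norm_bound[OF assms(1-4)] by metis
  have "max_word_norm n m (\<lambda>i. fourier G n \<rho> (Q i)) N \<le> C * (2 * max_tv N)" for N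
    using max_word_norm_attained[OF one_le_m] C(2) by metis
  then show ?thesis
    using max_word_norm_nonneg[OF one_le_m] max_tv_nonneg C(1) lim
    by (intro limit_le_limit_if_le_mult[OF _ _ _ _ jsr_LIMSEQ[OF fourier_carrier one_le_m] lim]) auto
qed

end

section \<open>Orthonormal families of functions\<close>

definition ip :: "'x set \<Rightarrow> ('x \<Rightarrow> complex) \<Rightarrow> ('x \<Rightarrow> complex) \<Rightarrow> complex" where
  "ip X u v = (\<Sum>x\<in>X. cnj (u x) * v x)"

text \<open>Members vanish off \<open>X\<close>, so they are determined by their values on
  \<open>X\<close> and \<open>ip X\<close> is definite on them for finite \<open>X\<close>.\<close>

definition fun_subspace :: "'x set \<Rightarrow> ('x \<Rightarrow> complex) set \<Rightarrow> bool" where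
  "fun_subspace X U \<longleftrightarrow> (\<forall>u\<in>U. \<forall>x. x \<notin> X \<longrightarrow> u x = 0) \<and> (\<lambda>_. 0) \<in> U \<and>
     (\<forall>u\<in>U. \<forall>v\<in>U. (\<lambda>x. u x + v x) \<in> U) \<and> (\<forall>c. \<forall>u\<in>U. (\<lambda>x. c * u x) \<in> U)"

definition orthonormal_in :: "'x set \<Rightarrow> ('x \<Rightarrow> complex) set \<Rightarrow> nat \<Rightarrow> (nat \<Rightarrow> 'x \<Rightarrow> complex) \<Rightarrow> bool" where
  "orthonormal_in X U d e \<longleftrightarrow> (\<forall>i<d. e i \<in> U) \<and> (\<forall>i<d. \<forall>j<d. ip X (e i) (e j) = (if i = j then 1 else 0))"

definition orthonormal_basis :: "'x set \<Rightarrow> ('x \<Rightarrow> complex) set \<Rightarrow> nat \<Rightarrow> (nat \<Rightarrow> 'x \<Rightarrow> complex) \<Rightarrow> bool" where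
  "orthonormal_basis X U d e \<longleftrightarrow> orthonormal_in X U d e \<and> (\<forall>u\<in>U. u = (\<lambda>x. \<Sum>i<d. ip X (e i) u * e i x))"

definition orth_compl :: "'x set \<Rightarrow> ('x \<Rightarrow> complex) set \<Rightarrow> ('x \<Rightarrow> complex) set \<Rightarrow> ('x \<Rightarrow> complex) set" where
  "orth_compl X U W = {u \<in> U. \<forall>v\<in>W. ip X v u = 0}"

lemma cnj_ip: "cnj (ip X u v) = ip X v u"
  by (simp add: ip_def mult.commute)

lemma ip_add_right: "ip X u (\<lambda>x. v x + w x) = ip X u v + ip X u w"
  by (simp add: ip_def distrib_left sum.distrib)

lemma ip_diff_right: "ip X u (\<lambda>x. v x - w x) = ip X u v - ip X u w"
  by (simp add: ip_def right_diff_distrib sum_subtractf)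

lemma ip_scale_right: "ip X u (\<lambda>x. c * v x) = c * ip X u v"
  by (simp add: ip_def sum_distrib_left mult.left_commute)

lemma ip_scale_left: "ip X (\<lambda>x. c * u x) v = cnj c * ip X u v"
  by (simp add: ip_def sum_distrib_left mult.assoc)

lemma ip_sum_right: "ip X u (\<lambda>x. \<Sum>i\<in>I. c i * e i x) = (\<Sum>i\<in>I. c i * ip X u (e i))"
  unfolding ip_def sum_distrib_left by (subst sum.swap) (simp add: mult.left_commute)

lemma ip_zero_right: "ip X u (\<lambda>_. 0) = 0"
  by (simp add: ip_def)

lemma ip_self: "ip X u u = complex_of_real (\<Sum>x\<in>X. (cmod (u x))\<^sup>2)"
  unfolding ip_def of_real_sum complex_norm_square by (simp add: mult.commute)

lemma ip_self_eq_0_iff: "finite X \<Longrightarrow> ip X u u = 0 \<longleftrightarrow> (\<forall>x\<in>X. u x = 0)"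
  unfolding ip_self of_real_eq_0_iff by (simp add: sum_nonneg_eq_0_iff)

lemma fun_subspaceD:
  assumes "fun_subspace X U" "u \<in> U"
  shows fun_subspace_outside: "x \<notin> X \<Longrightarrow> u x = 0"
    and fun_subspace_add: "v \<in> U \<Longrightarrow> (\<lambda>x. u x + v x) \<in> U"
    and fun_subspace_scale: "(\<lambda>x. c * u x) \<in> U"
  using assms by (simp_all add: fun_subspace_def)

lemma fun_subspace_sum:
  fixes d :: nat
  assumes U: "fun_subspace X U" and e: "\<And>i. i < d \<Longrightarrow> e i \<in> U"
  shows "(\<lambda>x. \<Sum>i<d. c i * e i x) \<in> U"
  using e
proof (induction d)
  case 0
  then show ?case using U by (simp add: fun_subspace_def)
next
  case (Suc d)
  have "(\<lambda>x. (\<Sum>i<d. c i * e i x) + c d * e d x) \<in> U"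
    by (intro fun_subspace_add[OF U] fun_subspace_scale[OF U] Suc) simp_all
  then show ?case by simp
qed

lemma fun_subspace_diff:
  assumes U: "fun_subspace X U" and "u \<in> U" "v \<in> U"
  shows "(\<lambda>x. u x - v x) \<in> U"
proof -
  have "(\<lambda>x. u x + -1 * v x) \<in> U"
    by (intro fun_subspace_add[OF U] fun_subspace_scale[OF U] assms)
  then show ?thesis by simp
qed

lemma orthonormal_coeff:
  assumes e: "orthonormal_in X U d e" and j: "j < d"
  shows "ip X (e j) (\<lambda>x. \<Sum>i<d. c i * e i x) = c j"
proof -
  have "ip X (e j) (\<lambda>x. \<Sum>i<d. c i * e i x) = (\<Sum>i<d. if i = j then c i else 0)"
    unfolding ip_sum_right using e j by (intro sum.cong) (auto simp: orthonormal_in_def)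
  then show ?thesis using j by simp
qed

lemma orthonormal_mono: "orthonormal_in X W d e \<Longrightarrow> W \<subseteq> U \<Longrightarrow> orthonormal_in X U d e"
  unfolding orthonormal_in_def by blast

text \<open>Bessel's inequality for the point masses, obtained by evaluating their projections
  \<open>s\<close>: the value \<open>s x\<close> equals the squared norm of \<open>s\<close>.\<close>

lemma orthonormal_sum_square_le_one:
  assumes X: "finite X" and e: "orthonormal_in X U d e" and x: "x \<in> X"
  shows "(\<Sum>i<d. (cmod (e i x))\<^sup>2) \<le> 1"
proof -
  define t where "t = (\<Sum>i<d. (cmod (e i x))\<^sup>2)"
  define s where "s y = (\<Sum>i<d. cnj (e i x) * e i y)" for y
  have t: "complex_of_real t = (\<Sum>i<d. cnj (e i x) * e i x)"
    unfolding t_def of_real_sum complex_norm_square by (simp add: mult.commute)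
  have "ip X s (e i) = e i x" if "i < d" for i
    using orthonormal_coeff[OF e that, of "\<lambda>i. cnj (e i x)"] cnj_ip[of X "e i" s]
    unfolding s_def by simp
  moreover have "ip X s s = (\<Sum>i<d. cnj (e i x) * ip X s (e i))"
    using ip_sum_right[of X s "\<lambda>i. cnj (e i x)" e "{..<d}"] unfolding s_def .
  ultimately have "ip X s s = complex_of_real t" using t by simp
  then have norm: "(\<Sum>y\<in>X. (cmod (s y))\<^sup>2) = t" unfolding ip_self of_real_eq_iff .
  have "s x = complex_of_real t" using t by (simp add: s_def)
  then have "t\<^sup>2 = (cmod (s x))\<^sup>2" by simp
  also have "\<dots> \<le> (\<Sum>y\<in>X. (cmod (s y))\<^sup>2)"
    using X x by (intro member_le_sum) auto
  finally have "t * t \<le> t" using norm by (simp add: power2_eq_square)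
  moreover have "0 \<le> t" unfolding t_def by (simp add: sum_nonneg)
  ultimately have "t \<le> 1" by (metis mult.right_neutral mult_le_cancel_left_pos order_le_less zero_le_one)
  then show ?thesis by (simp add: t_def)
qed

text \<open>Double counting of the squared values: each \<open>e i\<close> contributes exactly 1,
  each point of \<open>X\<close> at most 1.\<close>

lemma orthonormal_card_le:
  assumes X: "finite X" and e: "orthonormal_in X U d e"
  shows "d \<le> card X"
proof -
  have "(\<Sum>x\<in>X. (cmod (e i x))\<^sup>2) = 1" if "i < d" for i
  proof -
    have "ip X (e i) (e i) = complex_of_real 1" using e that by (simp add: orthonormal_in_def)
    then show ?thesis unfolding ip_self of_real_eq_iff .
  qed
  then have "real d = (\<Sum>i<d. \<Sum>x\<in>X. (cmod (e i x))\<^sup>2)" by simp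
  also have "\<dots> = (\<Sum>x\<in>X. \<Sum>i<d. (cmod (e i x))\<^sup>2)" by (rule sum.swap)
  also have "\<dots> \<le> (\<Sum>x\<in>X. 1)"
    by (intro sum_mono orthonormal_sum_square_le_one[OF X e])
  finally show ?thesis by simp
qed

lemma orthonormal_extend:
  assumes X: "finite X" and U: "fun_subspace X U" and e: "orthonormal_in X U d e"
    and r: "r \<in> U" "r \<noteq> (\<lambda>_. 0)" and orth: "\<And>i. i < d \<Longrightarrow> ip X (e i) r = 0"
  obtains e' where "orthonormal_in X U (Suc d) e'"
proof -
  define k where "k = sqrt (\<Sum>x\<in>X. (cmod (r x))\<^sup>2)"
  have k2: "ip X r r = complex_of_real (k\<^sup>2)"
    unfolding ip_self k_def by (simp add: sum_nonneg)
  have "ip X r r \<noteq> 0"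
    using r U unfolding ip_self_eq_0_iff[OF X] fun_subspace_def by (auto simp: fun_eq_iff)
  then have k0: "k \<noteq> 0" using k2 by auto
  define c where "c = complex_of_real (1 / k)"
  have c: "c * (cnj c * ip X r r) = 1"
    unfolding k2 c_def using k0 by (simp add: power2_eq_square)
  define e' where "e' i = (if i < d then e i else (\<lambda>x. c * r x))" for i
  have "ip X (\<lambda>x. c * r x) (e i) = 0" if "i < d" for i
    unfolding ip_scale_left using orth[OF that] cnj_ip[of X "e i" r] by simp
  then have "orthonormal_in X U (Suc d) e'"
    using e c orth fun_subspace_scale[OF U r(1)] unfolding orthonormal_in_def e'_def
    by (simp add: less_Suc_eq ip_scale_right ip_scale_left)
  then show ?thesis using that by blast
qed

text \<open>An orthonormal family of non-extendable length spans: the residual of a vector outside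
  the span could be normalised and appended.\<close>

lemma orthonormal_basis_exists:
  assumes X: "finite X" and U: "fun_subspace X U"
  obtains d e where "orthonormal_basis X U d e"
proof -
  define P where "P d \<longleftrightarrow> (\<exists>e. orthonormal_in X U d e)" for d
  have "P 0" by (simp add: P_def orthonormal_in_def)
  moreover have "\<not> P (Suc (card X))"
    using orthonormal_card_le[OF X, of U "Suc (card X)"] unfolding P_def by fastforce
  \<comment> \<open>Length 0 is possible and length \<open>Suc (card X)\<close> is not, so the
    property fails for the first time somewhere in between.\<close>
  ultimately obtain d where d: "P d" "\<not> P (Suc d)"
    using nat_induct[of P] by blast
  then obtain e where e: "orthonormal_in X U d e" unfolding P_def by blast
  have "u = (\<lambda>x. \<Sum>i<d. ip X (e i) u * e i x)" if u: "u \<in> U" for u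
  proof (rule ccontr)
    let ?p = "\<lambda>x. \<Sum>i<d. ip X (e i) u * e i x"
    assume "u \<noteq> ?p"
    then have nz: "(\<lambda>x. u x - ?p x) \<noteq> (\<lambda>_. 0)" by (auto simp: fun_eq_iff)
    have "?p \<in> U"
      using e by (intro fun_subspace_sum[OF U]) (simp add: orthonormal_in_def)
    then have mem: "(\<lambda>x. u x - ?p x) \<in> U" by (rule fun_subspace_diff[OF U u])
    have orth: "ip X (e i) (\<lambda>x. u x - ?p x) = 0" if "i < d" for i
      unfolding ip_diff_right orthonormal_coeff[OF e that] by simp
    obtain e' where "orthonormal_in X U (Suc d) e'"
      by (rule orthonormal_extend[OF X U e mem nz orth])
    then show False using d unfolding P_def by blast
  qed
  then show ?thesis using e that unfolding orthonormal_basis_def by blast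
qed

lemma fun_subspace_orth_compl:
  assumes U: "fun_subspace X U"
  shows "fun_subspace X (orth_compl X U W)"
  using U unfolding fun_subspace_def orth_compl_def
  by (auto simp: ip_add_right ip_scale_right ip_zero_right)

lemma orthogonal_split:
  assumes X: "finite X" and U: "fun_subspace X U" and W: "fun_subspace X W" "W \<subseteq> U" and u: "u \<in> U"
  obtains p where "p \<in> W" "(\<lambda>x. u x - p x) \<in> orth_compl X U W"
proof -
  obtain d e where e: "orthonormal_basis X W d e"
    using orthonormal_basis_exists[OF X W(1)] .
  have on: "orthonormal_in X W d e" using e by (simp add: orthonormal_basis_def)
  define p where "p = (\<lambda>x. \<Sum>i<d. ip X (e i) u * e i x)"
  have p: "p \<in> W" using on unfolding p_def
    by (intro fun_subspace_sum[OF W(1)]) (simp add: orthonormal_in_def)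
  have coeff: "ip X (\<lambda>x. u x - p x) (e i) = 0" if "i < d" for i
  proof -
    have "ip X (e i) (\<lambda>x. u x - p x) = 0"
      unfolding ip_diff_right p_def orthonormal_coeff[OF on that] by simp
    then show ?thesis using cnj_ip[of X "e i" "\<lambda>x. u x - p x"] by simp
  qed
  have "ip X v (\<lambda>x. u x - p x) = 0" if "v \<in> W" for v
  proof -
    have v: "v = (\<lambda>x. \<Sum>i<d. ip X (e i) v * e i x)"
      using e that by (simp add: orthonormal_basis_def)
    have "ip X (\<lambda>x. u x - p x) v = 0"
      by (subst v, subst ip_sum_right) (simp add: coeff)
    then show ?thesis using cnj_ip[of X "\<lambda>x. u x - p x" v] by simp
  qed
  moreover have "(\<lambda>x. u x - p x) \<in> U"
    using p W u by (intro fun_subspace_diff[OF U]) auto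
  ultimately show ?thesis using that p unfolding orth_compl_def by blast
qed

text \<open>A nonzero \<open>r\<close> orthogonal to \<open>W\<close> extends every orthonormal
  family of \<open>W\<close> inside \<open>U\<close>. This is the strict drop in dimension behind
  the induction on subspaces.\<close>

lemma orthonormal_length_drop:
  assumes X: "finite X" and U: "fun_subspace X U" and W: "W \<subseteq> U"
    and bound: "\<And>d e. orthonormal_in X U d e \<Longrightarrow> d \<le> n"
    and r: "r \<in> U" "r \<noteq> (\<lambda>_. 0)" "\<And>v. v \<in> W \<Longrightarrow> ip X v r = 0"
    and e: "orthonormal_in X W d e"
  shows "d < n"
proof -
  have "ip X (e i) r = 0" if "i < d" for i
    using e r(3) that unfolding orthonormal_in_def by blast
  then obtain e' where "orthonormal_in X U (Suc d) e'"
    by (rule orthonormal_extend[OF X U orthonormal_mono[OF e W] r(1,2)])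
  then show ?thesis using bound[of "Suc d" e'] by simp
qed

section \<open>Decay on invariant subspaces\<close>

context homogeneous_walk
begin

section \<open>Translations and the unitary representations on invariant subspaces\<close>

definition translate :: "'a \<Rightarrow> ('c \<Rightarrow> complex) \<Rightarrow> 'c \<Rightarrow> complex" where
  "translate g u x = (if x \<in> X then u (\<phi> (inv g) x) else 0)"

definition invariant :: "('c \<Rightarrow> complex) set \<Rightarrow> bool" where
  "invariant U \<longleftrightarrow> (\<forall>g\<in>carrier G. \<forall>u\<in>U. translate g u \<in> U)"

text \<open>The matrix of \<open>translate g\<close> in the basis \<open>e\<close>, whenever
  \<open>e\<close> is an orthonormal basis of an invariant subspace.\<close>

definition matrix_rep :: "nat \<Rightarrow> (nat \<Rightarrow> 'c \<Rightarrow> complex) \<Rightarrow> 'a \<Rightarrow> complex mat" where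
  "matrix_rep d e g = mat d d (\<lambda>(i, j). ip X (e i) (translate g (e j)))"

lemma translate_sum:
  "translate g (\<lambda>x. \<Sum>i\<in>I. c i * e i x) = (\<lambda>x. \<Sum>i\<in>I. c i * translate g (e i) x)"
  by (auto simp: translate_def fun_eq_iff)

lemma translate_one: "(\<And>x. x \<notin> X \<Longrightarrow> u x = 0) \<Longrightarrow> translate \<one> u = u"
  by (auto simp: translate_def fun_eq_iff action_one)

lemma translate_mult:
  "g \<in> carrier G \<Longrightarrow> h \<in> carrier G \<Longrightarrow> translate (g \<otimes> h) u = translate g (translate h u)"
  by (auto simp: translate_def fun_eq_iff inv_mult_group composition_rule action_closed)

text \<open>Reindexing along the permutation of \<open>X\<close> shows that the adjoint of a
  translation is its inverse. Both unitarity and the invariance of orthogonal complements follow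
  from this.\<close>

lemma ip_translate_right:
  assumes g: "g \<in> carrier G"
  shows "ip X u (translate g v) = ip X (translate (inv g) u) v"
proof -
  have "ip X u (translate g v) = (\<Sum>x\<in>X. cnj (u (\<phi> g (\<phi> (inv g) x))) * v (\<phi> (inv g) x))"
    using g unfolding ip_def by (intro sum.cong) (auto simp: translate_def action_inv_right)
  also have "\<dots> = (\<Sum>x\<in>X. cnj (u (\<phi> g x)) * v x)" using g by (rule sum_action_inv)
  also have "\<dots> = ip X (translate (inv g) u) v"
    using g unfolding ip_def by (intro sum.cong) (auto simp: translate_def)
  finally show ?thesis .
qed

lemma matrix_rep_carrier: "matrix_rep d e g \<in> carrier_mat d d"
  by (simp add: matrix_rep_def)

lemma translate_basis:
  assumes e: "orthonormal_basis X U d e" and U: "invariant U" and g: "g \<in> carrier G" and j: "j < d"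
  shows "translate g (e j) = (\<lambda>x. \<Sum>i<d. matrix_rep d e g $$ (i, j) * e i x)"
proof -
  have "translate g (e j) \<in> U"
    using e U g j by (simp add: orthonormal_basis_def orthonormal_in_def invariant_def)
  then have "translate g (e j) = (\<lambda>x. \<Sum>i<d. ip X (e i) (translate g (e j)) * e i x)"
    using e by (simp add: orthonormal_basis_def)
  also have "\<dots> = (\<lambda>x. \<Sum>i<d. matrix_rep d e g $$ (i, j) * e i x)"
    using j by (simp add: matrix_rep_def)
  finally show ?thesis .
qed

lemma translate_combination:
  assumes e: "orthonormal_basis X U d e" and U: "invariant U" and g: "g \<in> carrier G"
    and v: "v \<in> carrier_vec d"
  shows "translate g (\<lambda>x. \<Sum>i<d. v $ i * e i x) = (\<lambda>x. \<Sum>i<d. (matrix_rep d e g *\<^sub>v v) $ i * e i x)"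
proof -
  have "translate g (\<lambda>x. \<Sum>i<d. v $ i * e i x)
      = (\<lambda>x. \<Sum>j<d. \<Sum>i<d. matrix_rep d e g $$ (i, j) * v $ j * e i x)"
    unfolding translate_sum by (simp add: translate_basis[OF e U g] sum_distrib_left mult_ac)
  also have "\<dots> = (\<lambda>x. \<Sum>i<d. (matrix_rep d e g *\<^sub>v v) $ i * e i x)"
    by (subst sum.swap) (simp add: mult_mat_vec_index[OF matrix_rep_carrier v] sum_distrib_right)
  finally show ?thesis .
qed

lemma matrix_rep_equivariant:
  assumes "orthonormal_basis X U d e" "invariant U"
  shows "equivariant d (matrix_rep d e) e"
  unfolding equivariant_def
proof (intro ballI)
  fix g x and v :: "complex vec" assume *: "g \<in> carrier G" "v \<in> carrier_vec d" "x \<in> X"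
  show "(\<Sum>i<d. (matrix_rep d e g *\<^sub>v v) $ i * e i x) = (\<Sum>i<d. v $ i * e i (\<phi> (inv g) x))"
    using fun_cong[OF translate_combination[OF assms *(1,2)], of x] *(3)
    by (simp add: translate_def)
qed

lemma matrix_rep_appears:
  assumes e: "orthonormal_basis X U d e" and "invariant U"
  shows "appears_in G X \<phi> d (matrix_rep d e)"
proof -
  have on: "orthonormal_in X U d e" using e by (simp add: orthonormal_basis_def)
  have "v = 0\<^sub>v d"
    if v: "v \<in> carrier_vec d" and zero: "\<forall>x\<in>X. (\<Sum>i<d. v $ i * e i x) = 0" for v
  proof (rule eq_vecI)
    fix i assume "i < dim_vec (0\<^sub>v d :: complex vec)"
    then have i: "i < d" by simp
    have "v $ i = ip X (e i) (\<lambda>x. \<Sum>i<d. v $ i * e i x)"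
      using orthonormal_coeff[OF on i] by simp
    also have "\<dots> = 0" using zero by (simp add: ip_def)
    finally show "v $ i = 0\<^sub>v d $ i" using i by simp
  qed (use v in simp)
  then show ?thesis
    using matrix_rep_equivariant[OF assms] unfolding appears_in_def equivariant_def
    by (intro exI[of _ e] conjI ballI impI) blast+
qed

lemma matrix_rep_one:
  assumes U: "fun_subspace X U" and e: "orthonormal_in X U d e"
  shows "matrix_rep d e \<one> = 1\<^sub>m d"
proof (rule eq_matI)
  fix i j assume "i < dim_row (1\<^sub>m d :: complex mat)" "j < dim_col (1\<^sub>m d :: complex mat)"
  then have ij: "i < d" "j < d" by auto
  then have "translate \<one> (e j) = e j"
    using e fun_subspace_outside[OF U] by (intro translate_one) (simp add: orthonormal_in_def)
  then show "matrix_rep d e \<one> $$ (i, j) = 1\<^sub>m d $$ (i, j)"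
    using ij e by (simp add: matrix_rep_def orthonormal_in_def)
qed (simp_all add: matrix_rep_def)

lemma matrix_rep_mult:
  assumes e: "orthonormal_basis X U d e" and U: "invariant U"
    and g: "g \<in> carrier G" and h: "h \<in> carrier G"
  shows "matrix_rep d e (g \<otimes> h) = matrix_rep d e g * matrix_rep d e h"
proof (rule eq_matI)
  let ?\<rho> = "matrix_rep d e"
  fix i j assume "i < dim_row (?\<rho> g * ?\<rho> h)" "j < dim_col (?\<rho> g * ?\<rho> h)"
  then have ij: "i < d" "j < d" by (auto simp: matrix_rep_def)
  have "?\<rho> (g \<otimes> h) $$ (i, j) = ip X (e i) (translate g (translate h (e j)))"
    using ij by (simp add: matrix_rep_def translate_mult g h)
  also have "\<dots> = (\<Sum>k<d. ?\<rho> h $$ (k, j) * ip X (e i) (translate g (e k)))"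
    by (simp only: translate_basis[OF e U h ij(2)] translate_sum ip_sum_right)
  also have "\<dots> = (\<Sum>k<d. ?\<rho> g $$ (i, k) * ?\<rho> h $$ (k, j))"
    using ij by (intro sum.cong) (auto simp: matrix_rep_def)
  also have "\<dots> = (?\<rho> g * ?\<rho> h) $$ (i, j)"
    using ij matrix_rep_carrier[of d e g] matrix_rep_carrier[of d e h]
    by (auto simp: scalar_prod_def lessThan_atLeast0)
  finally show "?\<rho> (g \<otimes> h) $$ (i, j) = (?\<rho> g * ?\<rho> h) $$ (i, j)" .
qed (simp_all add: matrix_rep_def)

lemma matrix_rep_adjoint:
  assumes g: "g \<in> carrier G"
  shows "mat d d (\<lambda>(i, j). cnj (matrix_rep d e g $$ (j, i))) = matrix_rep d e (inv g)"
  by (rule eq_matI) (auto simp: matrix_rep_def cnj_ip ip_translate_right[OF g]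
      ip_translate_right[OF inv_closed[OF g]] inv_inv[OF g])

lemma matrix_rep_unitary:
  assumes U: "fun_subspace X U" "invariant U" and e: "orthonormal_basis X U d e"
  shows "unitary_rep G d (matrix_rep d e)"
proof -
  have one: "matrix_rep d e \<one> = 1\<^sub>m d"
    using matrix_rep_one[OF U(1)] e by (simp add: orthonormal_basis_def)
  have "matrix_rep d e g * matrix_rep d e (inv g) = 1\<^sub>m d" if "g \<in> carrier G" for g
    using that by (simp add: one flip: matrix_rep_mult[OF e U(2)])
  then show ?thesis
    unfolding unitary_rep_def
    by (simp add: matrix_rep_adjoint matrix_rep_carrier one matrix_rep_mult[OF e U(2)])
qed

text \<open>A trivial representation would make \<open>e 0\<close> invariant under translations,
  hence constant by transitivity; sum zero then forces it to vanish, against norm 1.\<close>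

lemma matrix_rep_nontrivial:
  assumes U: "fun_subspace X U" "invariant U" and e: "orthonormal_basis X U d e"
    and zero: "\<And>u. u \<in> U \<Longrightarrow> (\<Sum>x\<in>X. u x) = 0"
  shows "\<not> trivial_rep G d (matrix_rep d e)"
proof
  assume triv: "trivial_rep G d (matrix_rep d e)"
  then have d: "d = 1" by (simp add: trivial_rep_def)
  have e0: "e 0 \<in> U" "ip X (e 0) (e 0) = 1"
    using e d by (auto simp: orthonormal_basis_def orthonormal_in_def)
  obtain x where x: "x \<in> X" using nonempty_space by blast
  have "e 0 y = e 0 x" if y: "y \<in> X" for y
  proof -
    obtain g where g: "g \<in> carrier G" "\<phi> g x = y" using unique_orbit x y by blast
    have "translate g (e 0) = e 0"
      using translate_basis[OF e U(2) g(1), of 0] triv g d by (simp add: trivial_rep_def)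
    then have "translate g (e 0) y = e 0 y" by simp
    moreover have "\<phi> (inv g) y = x" using g x action_inv_left by blast
    ultimately show ?thesis using y by (simp add: translate_def)
  qed
  then have "(\<Sum>y\<in>X. e 0 y) = of_nat (card X) * e 0 x" by simp
  then have "e 0 x = 0" using zero[OF e0(1)] card_space_pos by simp
  then have "ip X (e 0) (e 0) = 0" using \<open>\<And>y. y \<in> X \<Longrightarrow> e 0 y = e 0 x\<close> by (simp add: ip_def)
  then show False using e0 by simp
qed

section \<open>Geometric decay of functions of sum zero\<close>

definition walk_decay :: "real \<Rightarrow> ('c \<Rightarrow> complex) \<Rightarrow> bool" where
  "walk_decay r u \<longleftrightarrow> (\<exists>C. \<forall>N. \<forall>w\<in>words m N. \<forall>x\<in>X. cmod (walk w u x) \<le> C * r ^ N)"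

lemma walk_decay_add:
  assumes "walk_decay r u" "walk_decay r v"
  shows "walk_decay r (\<lambda>x. u x + v x)"
proof -
  obtain C D where C: "\<And>N w x. w \<in> words m N \<Longrightarrow> x \<in> X \<Longrightarrow> cmod (walk w u x) \<le> C * r ^ N"
    and D: "\<And>N w x. w \<in> words m N \<Longrightarrow> x \<in> X \<Longrightarrow> cmod (walk w v x) \<le> D * r ^ N"
    using assms unfolding walk_decay_def by blast
  have "cmod (walk w (\<lambda>x. u x + v x) x) \<le> (C + D) * r ^ N" if "w \<in> words m N" "x \<in> X" for N w x
    unfolding walk_add distrib_right
    using norm_triangle_ineq[of "walk w u x" "walk w v x"] C[OF that] D[OF that] by linarith
  then show ?thesis unfolding walk_decay_def by blast
qed

text \<open>In coordinates with respect to \<open>e\<close> the walk becomes the Fourier product,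
  whose norm is at most \<open>C * r ^ N\<close> because \<open>r\<close> exceeds the joint spectral
  radius.\<close>

lemma walk_decay_irreducible:
  assumes e: "orthonormal_basis X U d e" and U: "invariant U"
    and jsr: "jsr d m (\<lambda>i. fourier G d (matrix_rep d e) (Q i)) < r" and r: "0 < r" and u: "u \<in> U"
  shows "walk_decay r u"
proof -
  let ?F = "\<lambda>i. fourier G d (matrix_rep d e) (Q i)"
  obtain C where C: "0 < C" "\<And>N. max_word_norm d m ?F N \<le> C * r ^ N"
    using le_geometric_if_limit_less[OF max_word_norm_nonneg[OF one_le_m]
        jsr_LIMSEQ[OF fourier_carrier one_le_m] jsr r] by blast
  define v where "v = vec d (\<lambda>i. ip X (e i) u)"
  have v: "v \<in> carrier_vec d" by (simp add: v_def)
  have u_eq: "u = (\<lambda>x. \<Sum>i<d. v $ i * e i x)"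
    using e u by (simp add: orthonormal_basis_def v_def)
  define V where "V = (\<Sum>j<d. cmod (v $ j))"
  define E where "E = (\<Sum>x\<in>X. \<Sum>i<d. cmod (e i x))"
  have V0: "0 \<le> V" by (simp add: V_def sum_nonneg)
  have "cmod (walk w u x) \<le> (C * V * E) * r ^ N" if w: "w \<in> words m N" and x: "x \<in> X" for N w x
  proof -
    let ?W = "word_prod d ?F w"
    have W: "?W \<in> carrier_mat d d" by (rule fourier_word_carrier)
    have norm: "mat_norm ?W \<le> C * r ^ N"
      using mat_norm_le_max_word_norm[OF w] C(2) by (rule order.trans)
    have coeff: "cmod ((?W *\<^sub>v v) $ i) \<le> C * r ^ N * V" if i: "i < d" for i
    proof -
      have "cmod ((?W *\<^sub>v v) $ i) \<le> (\<Sum>j<d. cmod (?W $$ (i, j)) * cmod (v $ j))"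
        unfolding mult_mat_vec_index[OF W v i] by (rule order.trans[OF norm_sum]) (simp add: norm_mult)
      also have "\<dots> \<le> (\<Sum>j<d. C * r ^ N * cmod (v $ j))"
        using W i norm
        by (intro sum_mono mult_right_mono order.trans[OF mat_norm_entry_le norm]) auto
      finally show ?thesis by (simp add: V_def sum_distrib_left)
    qed
    have "walk w u x = (\<Sum>i<d. (?W *\<^sub>v v) $ i * e i x)"
      by (subst u_eq) (rule equivariant_walk[OF matrix_rep_carrier matrix_rep_equivariant[OF e U] v x, symmetric])
    also have "cmod \<dots> \<le> (\<Sum>i<d. cmod ((?W *\<^sub>v v) $ i) * cmod (e i x))"
      by (rule order.trans[OF norm_sum]) (simp add: norm_mult)
    also have "\<dots> \<le> (\<Sum>i<d. C * r ^ N * V * cmod (e i x))"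
      using coeff by (intro sum_mono mult_right_mono) auto
    also have "\<dots> = C * r ^ N * V * (\<Sum>i<d. cmod (e i x))" by (simp add: sum_distrib_left)
    also have "\<dots> \<le> C * r ^ N * V * E"
      unfolding E_def using C(1) r V0 finite_space x
      by (intro mult_left_mono member_le_sum[of x X "\<lambda>x. \<Sum>i<d. cmod (e i x)"]) (auto intro: sum_nonneg)
    finally show ?thesis by (simp add: mult_ac)
  qed
  then show ?thesis unfolding walk_decay_def by blast
qed

text \<open>The coordinate map \<open>T\<close> is an equivariant isomorphism onto \<open>U\<close>,
  so a proper nonzero invariant subspace of coordinate vectors is carried to one of
  \<open>U\<close>. Positive degree is assumed because \<open>irreducible_rep\<close> also fails in
  degree 0.\<close>

lemma reducible_split:
  assumes U: "fun_subspace X U" "invariant U" and e: "orthonormal_basis X U d e" and d: "0 < d"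
    and red: "\<not> irreducible_rep G d (matrix_rep d e)"
  obtains W where "fun_subspace X W" "invariant W" "W \<subseteq> U" "W \<noteq> U" "W \<noteq> {\<lambda>_. 0}"
proof -
  have on: "orthonormal_in X U d e" using e by (simp add: orthonormal_basis_def)
  obtain V where V: "subspace_vec d V" and inv: "\<forall>g\<in>carrier G. \<forall>v\<in>V. matrix_rep d e g *\<^sub>v v \<in> V"
    and ne: "V \<noteq> {0\<^sub>v d}" "V \<noteq> carrier_vec d"
    using red d unfolding irreducible_rep_def by blast
  have Vc: "V \<subseteq> carrier_vec d" using V by (simp add: subspace_vec_def)
  define T where "T v = (\<lambda>x. \<Sum>i<d. v $ i * e i x)" for v :: "complex vec"
  have Tinj: "v = v'" if "T v = T v'" "v \<in> carrier_vec d" "v' \<in> carrier_vec d" for v v'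
  proof (rule eq_vecI)
    fix i assume "i < dim_vec v'"
    then have "i < d" using that by simp
    then show "v $ i = v' $ i"
      using orthonormal_coeff[OF on, of i "\<lambda>i. v $ i"] orthonormal_coeff[OF on, of i "\<lambda>i. v' $ i"] that(1)
      unfolding T_def by simp
  qed (use that in simp)
  have TU: "T v \<in> U" for v
    unfolding T_def using on by (intro fun_subspace_sum[OF U(1)]) (simp add: orthonormal_in_def)
  have T0: "T (0\<^sub>v d) = (\<lambda>_. 0)" by (simp add: T_def)
  have Tadd: "(\<lambda>x. T v x + T v' x) = T (v + v')" if "v \<in> carrier_vec d" "v' \<in> carrier_vec d" for v v'
    using that by (auto simp: T_def distrib_right sum.distrib)
  have Tscale: "(\<lambda>x. c * T v x) = T (c \<cdot>\<^sub>v v)" if "v \<in> carrier_vec d" for c v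
    using that by (auto simp: T_def sum_distrib_left mult.assoc)
  show ?thesis
  proof (rule that[of "T ` V"])
    show "fun_subspace X (T ` V)"
      unfolding fun_subspace_def
    proof (intro conjI ballI allI impI)
      fix u x assume "u \<in> T ` V" "x \<notin> X"
      then show "u x = 0" using fun_subspace_outside[OF U(1)] TU by auto
    next
      show "(\<lambda>_. 0) \<in> T ` V" using T0 V unfolding subspace_vec_def by (metis image_eqI)
    next
      fix u u' assume "u \<in> T ` V" "u' \<in> T ` V"
      then obtain v v' where "u = T v" "u' = T v'" "v \<in> V" "v' \<in> V" by auto
      then show "(\<lambda>x. u x + u' x) \<in> T ` V"
        using Tadd[of v v'] V Vc unfolding subspace_vec_def by auto
    next
      fix c u assume "u \<in> T ` V"
      then obtain v where "u = T v" "v \<in> V" by auto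
      then show "(\<lambda>x. c * u x) \<in> T ` V"
        using Tscale[of v c] V Vc unfolding subspace_vec_def by auto
    qed
    show "invariant (T ` V)"
      unfolding invariant_def
    proof (intro ballI)
      fix g u assume g: "g \<in> carrier G" and "u \<in> T ` V"
      then obtain v where v: "u = T v" "v \<in> V" by auto
      then have "translate g u = T (matrix_rep d e g *\<^sub>v v)"
        using translate_combination[OF e U(2) g, of v] Vc unfolding T_def by auto
      then show "translate g u \<in> T ` V" using inv g v by auto
    qed
    show "T ` V \<subseteq> U" using TU by auto
    show "T ` V \<noteq> U"
    proof
      assume eq: "T ` V = U"
      have "carrier_vec d \<subseteq> V"
      proof
        fix v :: "complex vec" assume v: "v \<in> carrier_vec d"
        then obtain v' where "T v = T v'" "v' \<in> V" using TU[of v] eq by auto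
        then show "v \<in> V" using Tinj[of v v'] v Vc by auto
      qed
      then show False using Vc ne(2) by blast
    qed
    show "T ` V \<noteq> {\<lambda>_. 0}"
    proof
      assume eq: "T ` V = {\<lambda>_. 0}"
      have "v = 0\<^sub>v d" if "v \<in> V" for v
        using Tinj[of v "0\<^sub>v d"] that eq T0 Vc by auto
      moreover have "0\<^sub>v d \<in> V" using V by (simp add: subspace_vec_def)
      ultimately show False using ne(1) by blast
    qed
  qed
qed

lemma invariant_orth_compl:
  assumes "invariant U" "invariant W"
  shows "invariant (orth_compl X U W)"
  using assms unfolding invariant_def orth_compl_def by (auto simp: ip_translate_right)

text \<open>Complete reducibility as an induction: \<open>n\<close> bounds the lengths of
  orthonormal families and plays the part of the dimension. A reducible \<open>U\<close> splits into
  \<open>W\<close> and its orthogonal complement, both with a smaller bound, and decay is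
  additive.\<close>

lemma walk_decay_invariant_subspace:
  assumes jsr: "\<And>n \<rho>. unitary_rep G n \<rho> \<Longrightarrow> irreducible_rep G n \<rho> \<Longrightarrow> \<not> trivial_rep G n \<rho>
        \<Longrightarrow> appears_in G X \<phi> n \<rho> \<Longrightarrow> jsr n m (\<lambda>i. fourier G n \<rho> (Q i)) < r"
    and r: "0 < r"
    and "fun_subspace X U" "invariant U" "\<And>u. u \<in> U \<Longrightarrow> (\<Sum>x\<in>X. u x) = 0"
    and "\<And>d e. orthonormal_in X U d e \<Longrightarrow> d \<le> n"
    and "u \<in> U"
  shows "walk_decay r u"
  using assms(3-)
proof (induction n arbitrary: U u rule: less_induct)
  case (less n)
  note U = less.prems(1,2) and zero = less.prems(3) and bound = less.prems(4) and u = less.prems(5)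
  obtain d e where e: "orthonormal_basis X U d e"
    using orthonormal_basis_exists[OF finite_space U(1)] .
  consider "d = 0" | "irreducible_rep G d (matrix_rep d e)"
    | "0 < d" "\<not> irreducible_rep G d (matrix_rep d e)" by blast
  then show ?case
  proof cases
    case 1
    then have "u = (\<lambda>_. 0)" using e u by (simp add: orthonormal_basis_def)
    then have "walk w u x = 0" for w x by (simp add: walk_def)
    then show ?thesis unfolding walk_decay_def by (auto intro!: exI[of _ 0])
  next
    case 2
    then have "jsr d m (\<lambda>i. fourier G d (matrix_rep d e) (Q i)) < r"
      by (intro jsr matrix_rep_unitary[OF U e] matrix_rep_nontrivial[OF U e zero]
          matrix_rep_appears[OF e U(2)])
    then show ?thesis using e U(2) r u by (intro walk_decay_irreducible)
  next
    case 3
    then obtain W where W: "fun_subspace X W" "invariant W" "W \<subseteq> U" "W \<noteq> U" "W \<noteq> {\<lambda>_. 0}"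
      using reducible_split[OF U e] by metis
    let ?P = "orth_compl X U W"
    have P: "fun_subspace X ?P" "invariant ?P" "?P \<subseteq> U"
      using fun_subspace_orth_compl[OF U(1)] invariant_orth_compl[OF U(2) W(2)]
      by (auto simp: orth_compl_def)
    obtain p where p: "p \<in> W" "(\<lambda>x. u x - p x) \<in> ?P"
      using orthogonal_split[OF finite_space U(1) W(1,3) u] .
    \<comment> \<open>The residual \<open>a - b\<close> after projecting to \<open>W\<close> is the
      nonzero vector orthogonal to \<open>W\<close> that makes \<open>W\<close> smaller than
      \<open>U\<close>.\<close>
    obtain a where a: "a \<in> U" "a \<notin> W" using W(3,4) by blast
    obtain b where b: "b \<in> W" "(\<lambda>x. a x - b x) \<in> ?P"
      using orthogonal_split[OF finite_space U(1) W(1,3) a(1)] .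
    have "a \<noteq> b" using a b by blast
    have Wlt: "d' < n" if on: "orthonormal_in X W d' e'" for d' e'
    proof (rule orthonormal_length_drop[OF finite_space U(1) W(3) _ _ _ _ on])
      show "d'' \<le> n" if "orthonormal_in X U d'' e''" for d'' e'' using that by (rule bound)
      show "(\<lambda>x. a x - b x) \<in> U" using b(2) P(3) by blast
      show "(\<lambda>x. a x - b x) \<noteq> (\<lambda>_. 0)" using \<open>a \<noteq> b\<close> by (auto simp: fun_eq_iff)
      show "ip X v (\<lambda>x. a x - b x) = 0" if "v \<in> W" for v
        using b(2) that unfolding orth_compl_def by blast
    qed
    \<comment> \<open>Symmetrically, a nonzero \<open>c\<close> in \<open>W\<close> is orthogonal to
      the complement and makes the complement smaller than \<open>U\<close>.\<close>
    obtain c where c: "c \<in> W" "c \<noteq> (\<lambda>_. 0)" using W(1,5) unfolding fun_subspace_def by blast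
    have Plt: "d' < n" if on: "orthonormal_in X ?P d' e'" for d' e'
    proof (rule orthonormal_length_drop[OF finite_space U(1) P(3) _ _ c(2) _ on])
      show "d'' \<le> n" if "orthonormal_in X U d'' e''" for d'' e'' using that by (rule bound)
      show "c \<in> U" using c(1) W(3) by blast
      show "ip X v c = 0" if "v \<in> ?P" for v
        using that c(1) cnj_ip[of X c v] unfolding orth_compl_def by simp
    qed
    \<comment> \<open>The empty family has length 0, and its length lies strictly below
      \<open>n\<close>.\<close>
    have n: "0 < n" using Wlt[of 0 e] by (simp add: orthonormal_in_def)
    have "walk_decay r p"
    proof (rule less.IH[OF _ W(1,2) _ _ p(1)])
      show "n - 1 < n" using n by simp
      show "(\<Sum>x\<in>X. v x) = 0" if "v \<in> W" for v using that W(3) zero by blast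
      show "d' \<le> n - 1" if "orthonormal_in X W d' e'" for d' e' using Wlt[OF that] by simp
    qed
    moreover have "walk_decay r (\<lambda>x. u x - p x)"
    proof (rule less.IH[OF _ P(1,2) _ _ p(2)])
      show "n - 1 < n" using n by simp
      show "(\<Sum>x\<in>X. v x) = 0" if "v \<in> ?P" for v using that P(3) zero by blast
      show "d' \<le> n - 1" if "orthonormal_in X ?P d' e'" for d' e' using Plt[OF that] by simp
    qed
    ultimately have "walk_decay r (\<lambda>x. p x + (u x - p x))" by (rule walk_decay_add)
    then show ?thesis by simp
  qed
qed

section \<open>The two inequalities and the mixing criterion\<close>

lemma walk_decay_centered_point:
  assumes jsr: "\<And>n \<rho>. unitary_rep G n \<rho> \<Longrightarrow> irreducible_rep G n \<rho> \<Longrightarrow> \<not> trivial_rep G n \<rho>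
        \<Longrightarrow> appears_in G X \<phi> n \<rho> \<Longrightarrow> jsr n m (\<lambda>i. fourier G n \<rho> (Q i)) < r"
    and r: "0 < r" and x0: "x0 \<in> X"
  shows "walk_decay r (centered_point x0)"
proof (rule walk_decay_invariant_subspace[OF jsr r])
  let ?U = "{u. (\<forall>x. x \<notin> X \<longrightarrow> u x = 0) \<and> (\<Sum>x\<in>X. u x) = 0}"
  show "fun_subspace X ?U"
    by (auto simp: fun_subspace_def sum.distrib simp flip: sum_distrib_left)
  show "invariant ?U"
    unfolding invariant_def by (auto simp: translate_def sum_action_inv)
  show "centered_point x0 \<in> ?U"
    using sum_centered_point[OF x0] by (simp add: centered_point_def)
  show "d \<le> card X" if "orthonormal_in X ?U d e" for d e
    using finite_space that by (rule orthonormal_card_le)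
qed auto

lemma max_tv_geometric_bound:
  assumes jsr: "\<And>n \<rho>. unitary_rep G n \<rho> \<Longrightarrow> irreducible_rep G n \<rho> \<Longrightarrow> \<not> trivial_rep G n \<rho>
        \<Longrightarrow> appears_in G X \<phi> n \<rho> \<Longrightarrow> jsr n m (\<lambda>i. fourier G n \<rho> (Q i)) < r"
    and r: "0 < r"
  obtains C where "0 < C" "\<And>N. 2 * max_tv N \<le> C * r ^ N"
proof -
  have "\<forall>x0\<in>X. \<exists>C. \<forall>N. \<forall>w\<in>words m N. \<forall>x\<in>X. cmod (walk w (centered_point x0) x) \<le> C * r ^ N"
    using walk_decay_centered_point[OF jsr r] unfolding walk_decay_def by blast
  then obtain C where C: "\<forall>x0\<in>X. \<forall>N. \<forall>w\<in>words m N. \<forall>x\<in>X.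
      cmod (walk w (centered_point x0) x) \<le> C x0 * r ^ N"
    by (rule bchoice[THEN exE])
  \<comment> \<open>The sum dominates the constants of all starting points, \<open>card X\<close>
    comes from summing over the target points, and 1 ensures positivity.\<close>
  define D where "D = real (card X) * (\<Sum>x0\<in>X. \<bar>C x0\<bar>) + 1"
  have S0: "0 \<le> (\<Sum>x0\<in>X. \<bar>C x0\<bar>)" by (simp add: sum_nonneg)
  have "2 * max_tv N \<le> D * r ^ N" for N
  proof -
    obtain x0 w where x0: "x0 \<in> X" and w: "w \<in> words m N"
      and eq: "2 * max_tv N = (\<Sum>x\<in>X. cmod (deviation w x0 x))"
      by (rule max_tv_attained)
    have "C x0 \<le> \<bar>C x0\<bar>" by simp
    also have "\<dots> \<le> (\<Sum>x0\<in>X. \<bar>C x0\<bar>)"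
      using x0 finite_space by (intro member_le_sum) auto
    finally have Cx: "C x0 \<le> (\<Sum>x0\<in>X. \<bar>C x0\<bar>)" .
    have "2 * max_tv N \<le> (\<Sum>x\<in>X. (\<Sum>x0\<in>X. \<bar>C x0\<bar>) * r ^ N)"
      unfolding eq
    proof (rule sum_mono)
      fix x assume x: "x \<in> X"
      have "deviation w x0 x = walk w (centered_point x0) x"
        using w x0 x by (intro walk_centered_point[symmetric]) (auto simp: words_def)
      then have "cmod (deviation w x0 x) \<le> C x0 * r ^ N" using C x0 x w by metis
      also have "\<dots> \<le> (\<Sum>x0\<in>X. \<bar>C x0\<bar>) * r ^ N"
        using Cx r by (intro mult_right_mono) auto
      finally show "cmod (deviation w x0 x) \<le> (\<Sum>x0\<in>X. \<bar>C x0\<bar>) * r ^ N" .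
    qed
    also have "\<dots> \<le> D * r ^ N" using r by (simp add: D_def distrib_right mult.assoc)
    finally show ?thesis .
  qed
  moreover have "0 < D" using S0 by (simp add: D_def add_nonneg_pos)
  ultimately show ?thesis using that by blast
qed

lemma max_tv_root_LIMSEQ:
  shows "(\<lambda>N. (2 * max_tv N) powr (1 / real N)) \<longlonglongrightarrow> fourier_jsr G X \<phi> m Q"
    and "1 \<le> N \<Longrightarrow> fourier_jsr G X \<phi> m Q \<le> (2 * max_tv N) powr (1 / real N)"
proof -
  let ?J = "{jsr n m (\<lambda>i. fourier G n \<rho> (Q i)) | n \<rho>.
        unitary_rep G n \<rho> \<and> irreducible_rep G n \<rho> \<and> \<not> trivial_rep G n \<rho> \<and> appears_in G X \<phi> n \<rho>}"
  let ?\<omega> = "fourier_jsr G X \<phi> m Q"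
  have nonneg: "0 \<le> 2 * max_tv N" for N using max_tv_nonneg by simp
  obtain L where L: "(\<lambda>N. (2 * max_tv N) powr (1 / real N)) \<longlonglongrightarrow> L"
    "\<And>N. 1 \<le> N \<Longrightarrow> L \<le> (2 * max_tv N) powr (1 / real N)"
    using fekete_root_LIMSEQ[of "\<lambda>N. 2 * max_tv N", OF nonneg max_tv_submultiplicative]
    by blast
  have "0 \<le> L" by (rule LIMSEQ_le_const[OF L(1)]) simp
  moreover have "j \<le> L" if "j \<in> ?J" for j
  proof -
    from that obtain n \<rho> where j: "j = jsr n m (\<lambda>i. fourier G n \<rho> (Q i))" and \<rho>: "unitary_rep G n \<rho>"
      "irreducible_rep G n \<rho>" "\<not> trivial_rep G n \<rho>" "appears_in G X \<phi> n \<rho>" by auto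
    show ?thesis
      unfolding j using \<rho> L(1) by (intro jsr_le_max_tv_limit) (auto simp: unitary_rep_def)
  qed
  ultimately have upper: "\<And>j. j \<in> insert 0 ?J \<Longrightarrow> j \<le> L" by blast
  \<comment> \<open>The upper bound \<open>L\<close> also guarantees that the supremum in
    \<open>fourier_jsr\<close> is a genuine one.\<close>
  then have bdd: "bdd_above (insert 0 ?J)" by (rule bdd_aboveI)
  have "?\<omega> \<le> L" unfolding fourier_jsr_def by (rule cSup_least) (use upper in auto)
  moreover have "L \<le> ?\<omega>"
  proof (rule dense_ge)
    fix r assume r: "?\<omega> < r"
    have le: "j \<le> ?\<omega>" if "j \<in> insert 0 ?J" for j
      unfolding fourier_jsr_def using that bdd by (rule cSup_upper)
    \<comment> \<open>The inserted 0 makes the supremum nonnegative even if no nontrivial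
      irreducible appears.\<close>
    have "0 < r" using le[of 0] r by simp
    have jsr: "jsr n m (\<lambda>i. fourier G n \<rho> (Q i)) < r" if "unitary_rep G n \<rho>" "irreducible_rep G n \<rho>"
      "\<not> trivial_rep G n \<rho>" "appears_in G X \<phi> n \<rho>" for n \<rho>
    proof -
      have "jsr n m (\<lambda>i. fourier G n \<rho> (Q i)) \<in> insert 0 ?J" using that by blast
      from le[OF this] r show ?thesis by (rule le_less_trans)
    qed
    obtain C where C: "0 < C" "\<And>N. 2 * max_tv N \<le> C * r ^ N"
      using max_tv_geometric_bound[OF jsr \<open>0 < r\<close>] by blast
    show "L \<le> r"
      by (rule limit_le_if_le_geometric[of "\<lambda>N. 2 * max_tv N", OF nonneg C(1) \<open>0 < r\<close> C(2) L(1)])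
  qed
  ultimately have "L = ?\<omega>" by simp
  then show "(\<lambda>N. (2 * max_tv N) powr (1 / real N)) \<longlonglongrightarrow> ?\<omega>"
    "1 \<le> N \<Longrightarrow> ?\<omega> \<le> (2 * max_tv N) powr (1 / real N)"
    using L by auto
qed

text \<open>The factor 2 is removed by a constant \<open>1 / 2\<close>, whose roots tend to
  1.\<close>

lemma max_tv_root_tendsto_fourier_jsr:
  "(\<lambda>N. max_tv N powr (1 / real N)) \<longlonglongrightarrow> fourier_jsr G X \<phi> m Q"
proof -
  have "(\<lambda>N. (1 / 2) powr (1 / real N) * (2 * max_tv N) powr (1 / real N))
      \<longlonglongrightarrow> 1 * fourier_jsr G X \<phi> m Q"
    by (intro tendsto_mult const_powr_inverse_LIMSEQ max_tv_root_LIMSEQ) simp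
  moreover have "(1 / 2) powr (1 / real N) * (2 * max_tv N) powr (1 / real N) = max_tv N powr (1 / real N)" for N
    using max_tv_nonneg[of N] by (simp flip: powr_mult)
  ultimately show ?thesis by simp
qed

text \<open>Mixing yields some \<open>N\<close> at which \<open>2 * max_tv N\<close> is below 1, and
  the root at this \<open>N\<close> already bounds the limit. Conversely a rate strictly between the
  limit and 1 gives geometric decay.\<close>

lemma adversarial_mixing_iff: "adversarial_mixing G X \<phi> m Q \<longleftrightarrow> fourier_jsr G X \<phi> m Q < 1"
proof
  assume "adversarial_mixing G X \<phi> m Q"
  then have "\<forall>\<^sub>F N in sequentially. max_tv N < 1 / 2"
    unfolding adversarial_mixing_def by (rule order_tendstoD) simp
  then have "\<forall>\<^sub>F N in sequentially. max_tv N < 1 / 2 \<and> 1 \<le> N"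
    using eventually_ge_at_top by (rule eventually_conj)
  then obtain N where N: "max_tv N < 1 / 2" "1 \<le> N"
    by (auto simp: eventually_sequentially)
  have "fourier_jsr G X \<phi> m Q \<le> (2 * max_tv N) powr (1 / real N)"
    using N(2) by (rule max_tv_root_LIMSEQ)
  also have "\<dots> < 1 powr (1 / real N)"
    using N max_tv_nonneg[of N] by (intro powr_less_mono2) auto
  finally show "fourier_jsr G X \<phi> m Q < 1" by simp
next
  assume less: "fourier_jsr G X \<phi> m Q < 1"
  \<comment> \<open>The midpoint between the limit and 1; the maximum with \<open>1 / 2\<close>
    makes positivity immediate.\<close>
  define r where "r = max (1 / 2) ((fourier_jsr G X \<phi> m Q + 1) / 2)"
  have r: "fourier_jsr G X \<phi> m Q < r" "0 < r" "r < 1" using less by (auto simp: r_def less_max_iff_disj)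
  obtain C where C: "\<And>N. max_tv N \<le> C * r ^ N"
    using le_geometric_if_limit_less[OF max_tv_nonneg max_tv_root_tendsto_fourier_jsr r(1,2)] by blast
  have "(\<lambda>N. C * r ^ N) \<longlonglongrightarrow> C * 0"
    using r by (intro tendsto_mult tendsto_const LIMSEQ_power_zero) simp
  then have "max_tv \<longlonglongrightarrow> 0"
    using C max_tv_nonneg
    by (intro tendsto_sandwich[of "\<lambda>_. 0" max_tv _ "\<lambda>N. C * r ^ N"]) simp_all
  then show "adversarial_mixing G X \<phi> m Q" unfolding adversarial_mixing_def .
qed

end

theorem theorem1p6:
  fixes G :: "('g, 'b) monoid_scheme" and X :: "'x set" and \<phi> :: "'g \<Rightarrow> 'x \<Rightarrow> 'x"
    and m :: nat and Q :: "nat \<Rightarrow> 'g \<Rightarrow> real"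
  assumes "group G" and "finite (carrier G)"
    and "transitive_action G X \<phi>" and "finite X" and "X \<noteq> {}"
    and "m \<ge> 1" and "\<forall>i\<in>{1..m}. prob_dist G (Q i)"
  shows "((\<lambda>N. (max_dist G X \<phi> m Q N) powr (1 / real N)) \<longlonglongrightarrow> fourier_jsr G X \<phi> m Q)
         \<and> (adversarial_mixing G X \<phi> m Q \<longleftrightarrow> fourier_jsr G X \<phi> m Q < 1)"
proof -
  interpret homogeneous_walk G X \<phi> m Q
    using assms by (simp add: homogeneous_walk_def homogeneous_walk_axioms_def)
  show ?thesis
    using max_tv_root_tendsto_fourier_jsr adversarial_mixing_iff by blast
qed

end
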